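(* Let $P_1,P_2$ be non-commutative Poisson algebras over $K$ of the same class (both of Class 1 or both of Class 2), with degree maps $u_i:P_i\to\mathbb Z_{\ge0}\cup\{-\infty\}$ ($i=1,2$) whose induced filtrations are finite and discrete. Let $z_1\in P_1$, $z_2\in P_2$ and $\Gamma=z_1\otimes1+1\otimes z_2\in P_1\otimes P_2$. If $F(z_1)=C(z_1)\subsetneq P_1$, i.e. $z_1\in\Omega_0'(P_1)$, then $$F(\Gamma)=C(z_1)\otimes F(z_2),\quad N(\Gamma)=C(z_1)\otimes N(z_2),\quad D(\Gamma)=C(z_1)\otimes D(z_2),\quad C(\Gamma)=C(z_1)\otimes C(z_2).$$ In this case, for each $i\in\{0,1,2,3\}$: if $z_2\in\Omega_i(P_2)\cup\Omega_i'(P_2)$, then $\Gamma\in\Omega_i'(P_1\otimes P_2)$.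
   Context: $K$ is an algebraically closed field of characteristic zero; tensor products are over $K$. A non-commutative Poisson algebra over $K$ is a $K$-vector space $P$ with a bilinear product $\cdot$ making it a unital associative (not necessarily commutative) $K$-algebra and a bilinear bracket $\{\cdot,\cdot\}$ making it a Lie algebra, such that $\{x,yz\}=\{x,y\}z+y\{x,z\}$ for all $x,y,z\in P$. It is of Class 1 if $(P,\cdot)$ is commutative, and of Class 2 if $(P,\cdot)$ is non-commutative and $\{a,b\}=ab-ba$ for all $a,b$. Tensor product: if $P_1,P_2$ are both of Class 1, $P_1\otimes P_2$ carries the bracket $\{a_1\otimes a_2,b_1\otimes b_2\}=\{a_1,b_1\}\otimes a_2b_2+b_1a_1\otimes\{a_2,b_2\}$; if both are of Class 2, the bracket on $P_1\otimes P_2$ is the commutator. This makes $P_1\otimes P_2$ a non-commutative Poisson algebra of the same class. A degree map on $P$ is a map $u:P\to\mathbb Z\cup\{-\infty\}$ such that for all $z,w\in P$: $u(\{z,w\})\le u(zw)=u(z)+u(w)$; $u(z+w)\le\max\{u(z),u(w)\}$; $u(z)=-\infty$ iff $z=0$. Its induced filtration is $P_t=\{a\in P\mid u(a)\le t\}$, $t\in\mathbb Z$; it is finite if every $P_t$ is finite dimensional over $K$ and discrete if $P_t=\{0\}$ for all $t<0$. For an element $z$ of a non-commutative Poisson algebra $P$ put $ad_z(w)=\{z,w\}$ and $Ev(z)=\{\lambda\in K\mid \exists x\in P\setminus\{0\},\ ad_z(x)=\lambda x\}$, $F(z)=\{x\in P\mid \dim_K K[ad_z](x)<\infty\}$, $N(z)=\{x\in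 P\mid \exists m,\ ad_z^m(x)=0\}$, $C(z)=\{x\in P\mid ad_z(x)=0\}$, $D(z)=\bigoplus_{\lambda\in Ev(z)}\{x\in P\mid ad_z(x)=\lambda x\}$. For $z_i$ these are formed in $P_i$; for $\Gamma$ in $P_1\otimes P_2$. Types of elements. If $Ev(z)=\{0\}$: $z\in\Omega_0(P)$ if $C(z)=P$; $z\in\Omega_0'(P)$ if $C(z)=F(z)\subsetneq P$; $z\in\Omega_1(P)$ if $C(z)\subsetneq N(z)=P$; $z\in\Omega_1'(P)$ if $C(z)\subsetneq N(z)\subsetneq P$. If $Ev(z)\supsetneq\{0\}$: $z\in\Omega_2(P)$ if $D(z)=F(z)=P$; $z\in\Omega_2'(P)$ if $D(z)=F(z)\subsetneq P$; $z\in\Omega_3(P)$ if $D(z)\subsetneq F(z)=P$; $z\in\Omega_3'(P)$ if $D(z)\subsetneq F(z)\subsetneq P$. *)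

theory Defs
  imports
    "Jordan_Normal_Form.VS_Connect"
    "HOL-Algebra.QuotRing"
    "HOL-Library.Poly_Mapping"
    "HOL-Library.Extended"
begin

section \<open>Non-commutative Poisson algebras\<close>

text \<open>
  The scalars are a type of class \<open>field\<close>, seen as the HOL-Algebra ring \<open>class_ring\<close>;
  algebras over it are records with an explicit carrier, because the tensor product below is a
  set of cosets.
\<close>

record ('k, 'p) poisson = "('k, 'p) module" +
  bracket :: "'p \<Rightarrow> 'p \<Rightarrow> 'p"

locale nc_poisson_algebra =
  vectorspace "class_ring :: 'k::field ring" P + A?: ring P
  for P :: "('k::field, 'p) poisson" (structure) +
  assumes smult_mult_left:
      "\<lbrakk>x \<in> carrier P; y \<in> carrier P\<rbrakk> \<Longrightarrow> (c \<odot>\<^bsub>P\<^esub> x) \<otimes>\<^bsub>P\<^esub> y = c \<odot>\<^bsub>P\<^esub> (x \<otimes>\<^bsub>P\<^esub> y)"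
    and smult_mult_right:
      "\<lbrakk>x \<in> carrier P; y \<in> carrier P\<rbrakk> \<Longrightarrow> x \<otimes>\<^bsub>P\<^esub> (c \<odot>\<^bsub>P\<^esub> y) = c \<odot>\<^bsub>P\<^esub> (x \<otimes>\<^bsub>P\<^esub> y)"
    and bracket_closed:
      "\<lbrakk>x \<in> carrier P; y \<in> carrier P\<rbrakk> \<Longrightarrow> bracket P x y \<in> carrier P"
    and bracket_add_left:
      "\<lbrakk>x \<in> carrier P; y \<in> carrier P; z \<in> carrier P\<rbrakk> \<Longrightarrow>
        bracket P (x \<oplus>\<^bsub>P\<^esub> y) z = bracket P x z \<oplus>\<^bsub>P\<^esub> bracket P y z"
    and bracket_add_right:
      "\<lbrakk>x \<in> carrier P; y \<in> carrier P; z \<in> carrier P\<rbrakk> \<Longrightarrow>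
        bracket P x (y \<oplus>\<^bsub>P\<^esub> z) = bracket P x y \<oplus>\<^bsub>P\<^esub> bracket P x z"
    and bracket_smult_left:
      "\<lbrakk>x \<in> carrier P; y \<in> carrier P\<rbrakk> \<Longrightarrow> bracket P (c \<odot>\<^bsub>P\<^esub> x) y = c \<odot>\<^bsub>P\<^esub> bracket P x y"
    and bracket_smult_right:
      "\<lbrakk>x \<in> carrier P; y \<in> carrier P\<rbrakk> \<Longrightarrow> bracket P x (c \<odot>\<^bsub>P\<^esub> y) = c \<odot>\<^bsub>P\<^esub> bracket P x y"
    and bracket_self:
      "x \<in> carrier P \<Longrightarrow> bracket P x x = \<zero>\<^bsub>P\<^esub>"
    and jacobi:
      "\<lbrakk>x \<in> carrier P; y \<in> carrier P; z \<in> carrier P\<rbrakk> \<Longrightarrow>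
        bracket P x (bracket P y z) \<oplus>\<^bsub>P\<^esub> bracket P y (bracket P z x)
          \<oplus>\<^bsub>P\<^esub> bracket P z (bracket P x y) = \<zero>\<^bsub>P\<^esub>"
    and leibniz:
      "\<lbrakk>x \<in> carrier P; y \<in> carrier P; z \<in> carrier P\<rbrakk> \<Longrightarrow>
        bracket P x (y \<otimes>\<^bsub>P\<^esub> z) = bracket P x y \<otimes>\<^bsub>P\<^esub> z \<oplus>\<^bsub>P\<^esub> y \<otimes>\<^bsub>P\<^esub> bracket P x z"

definition class1 :: "('k, 'p) poisson \<Rightarrow> bool" where
  "class1 P \<longleftrightarrow> (\<forall>a\<in>carrier P. \<forall>b\<in>carrier P. a \<otimes>\<^bsub>P\<^esub> b = b \<otimes>\<^bsub>P\<^esub> a)"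

definition class2 :: "('k, 'p) poisson \<Rightarrow> bool" where
  "class2 P \<longleftrightarrow>
     \<not> (\<forall>a\<in>carrier P. \<forall>b\<in>carrier P. a \<otimes>\<^bsub>P\<^esub> b = b \<otimes>\<^bsub>P\<^esub> a) \<and>
     (\<forall>a\<in>carrier P. \<forall>b\<in>carrier P. bracket P a b = a \<otimes>\<^bsub>P\<^esub> b \<ominus>\<^bsub>P\<^esub> b \<otimes>\<^bsub>P\<^esub> a)"

abbreviation span_of :: "('k::field, 'p) poisson \<Rightarrow> 'p set \<Rightarrow> 'p set" where
  "span_of P S \<equiv> LinearCombinations.module.span class_ring P S"

text \<open>Finite dimensionality of a linear subspace \<open>W\<close> of \<open>P\<close>.\<close>

abbreviation fin_dim_in :: "('k::field, 'p) poisson \<Rightarrow> 'p set \<Rightarrow> bool" where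
  "fin_dim_in P W \<equiv> vectorspace.fin_dim class_ring (P\<lparr>carrier := W\<rparr>)"


section \<open>Degree maps\<close>

text \<open>
  Degrees in \<open>\<int> \<union> {-\<infinity>}\<close> are values of type \<open>int extended\<close> other than \<open>Pinf\<close>;
  \<open>Minf\<close> is \<open>-\<infinity>\<close>, and \<open>Minf + Fin n = Minf = Minf + Minf\<close>.
\<close>

definition degree_map :: "('k, 'p) poisson \<Rightarrow> ('p \<Rightarrow> int extended) \<Rightarrow> bool" where
  "degree_map P u \<longleftrightarrow>
     (\<forall>z\<in>carrier P. u z \<noteq> Pinf) \<and>
     (\<forall>z\<in>carrier P. \<forall>w\<in>carrier P.
        u (bracket P z w) \<le> u (z \<otimes>\<^bsub>P\<^esub> w) \<and>
        u (z \<otimes>\<^bsub>P\<^esub> w) = u z + u w \<and>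
        u (z \<oplus>\<^bsub>P\<^esub> w) \<le> max (u z) (u w)) \<and>
     (\<forall>z\<in>carrier P. u z = Minf \<longleftrightarrow> z = \<zero>\<^bsub>P\<^esub>)"

definition nonneg_valued :: "('k, 'p) poisson \<Rightarrow> ('p \<Rightarrow> int extended) \<Rightarrow> bool" where
  "nonneg_valued P u \<longleftrightarrow> (\<forall>z\<in>carrier P. u z = Minf \<or> (\<exists>n\<ge>0. u z = Fin n))"

definition filtration :: "('k, 'p) poisson \<Rightarrow> ('p \<Rightarrow> int extended) \<Rightarrow> int \<Rightarrow> 'p set" where
  "filtration P u t = {a \<in> carrier P. u a \<le> Fin t}"

definition finite_filtration :: "('k::field, 'p) poisson \<Rightarrow> ('p \<Rightarrow> int extended) \<Rightarrow> bool" where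
  "finite_filtration P u \<longleftrightarrow> (\<forall>t. fin_dim_in P (filtration P u t))"

definition discrete_filtration :: "('k, 'p) poisson \<Rightarrow> ('p \<Rightarrow> int extended) \<Rightarrow> bool" where
  "discrete_filtration P u \<longleftrightarrow> (\<forall>t<0. filtration P u t = {\<zero>\<^bsub>P\<^esub>})"


section \<open>The adjoint action and types of elements\<close>

definition ad :: "('k, 'p) poisson \<Rightarrow> 'p \<Rightarrow> 'p \<Rightarrow> 'p" where
  "ad P z w = bracket P z w"

definition eigenspace_ad :: "('k, 'p) poisson \<Rightarrow> 'p \<Rightarrow> 'k \<Rightarrow> 'p set" where
  "eigenspace_ad P z l = {x \<in> carrier P. ad P z x = l \<odot>\<^bsub>P\<^esub> x}"

definition Ev_ad :: "('k, 'p) poisson \<Rightarrow> 'p \<Rightarrow> 'k set" where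
  "Ev_ad P z = {l. \<exists>x \<in> carrier P - {\<zero>\<^bsub>P\<^esub>}. ad P z x = l \<odot>\<^bsub>P\<^esub> x}"

text \<open>\<open>K[ad\<^sub>z](x) = {p(ad\<^sub>z)(x) | p \<in> K[t]}\<close> consists of the linear combinations of the iterates
  of \<open>ad\<^sub>z\<close> on \<open>x\<close>.\<close>

definition orbit_space_ad :: "('k::field, 'p) poisson \<Rightarrow> 'p \<Rightarrow> 'p \<Rightarrow> 'p set" where
  "orbit_space_ad P z x = span_of P {(ad P z ^^ n) x | n. True}"

definition F_ad :: "('k::field, 'p) poisson \<Rightarrow> 'p \<Rightarrow> 'p set" where
  "F_ad P z = {x \<in> carrier P. fin_dim_in P (orbit_space_ad P z x)}"

definition N_ad :: "('k, 'p) poisson \<Rightarrow> 'p \<Rightarrow> 'p set" where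
  "N_ad P z = {x \<in> carrier P. \<exists>m. (ad P z ^^ m) x = \<zero>\<^bsub>P\<^esub>}"

definition C_ad :: "('k, 'p) poisson \<Rightarrow> 'p \<Rightarrow> 'p set" where
  "C_ad P z = {x \<in> carrier P. ad P z x = \<zero>\<^bsub>P\<^esub>}"

text \<open>The sum of eigenspaces for distinct eigenvalues is automatically direct.\<close>

definition D_ad :: "('k::field, 'p) poisson \<Rightarrow> 'p \<Rightarrow> 'p set" where
  "D_ad P z = span_of P (\<Union>l\<in>Ev_ad P z. eigenspace_ad P z l)"

definition Omega0 :: "('k::field, 'p) poisson \<Rightarrow> 'p set" where
  "Omega0 P = {z \<in> carrier P. Ev_ad P z = {0} \<and> C_ad P z = carrier P}"

definition Omega0' :: "('k::field, 'p) poisson \<Rightarrow> 'p set" where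
  "Omega0' P = {z \<in> carrier P. Ev_ad P z = {0} \<and> C_ad P z = F_ad P z \<and> F_ad P z \<subset> carrier P}"

definition Omega1 :: "('k::field, 'p) poisson \<Rightarrow> 'p set" where
  "Omega1 P = {z \<in> carrier P. Ev_ad P z = {0} \<and> C_ad P z \<subset> N_ad P z \<and> N_ad P z = carrier P}"

definition Omega1' :: "('k::field, 'p) poisson \<Rightarrow> 'p set" where
  "Omega1' P = {z \<in> carrier P. Ev_ad P z = {0} \<and> C_ad P z \<subset> N_ad P z \<and> N_ad P z \<subset> carrier P}"

definition Omega2 :: "('k::field, 'p) poisson \<Rightarrow> 'p set" where
  "Omega2 P = {z \<in> carrier P. {0} \<subset> Ev_ad P z \<and> D_ad P z = F_ad P z \<and> F_ad P z = carrier P}"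

definition Omega2' :: "('k::field, 'p) poisson \<Rightarrow> 'p set" where
  "Omega2' P = {z \<in> carrier P. {0} \<subset> Ev_ad P z \<and> D_ad P z = F_ad P z \<and> F_ad P z \<subset> carrier P}"

definition Omega3 :: "('k::field, 'p) poisson \<Rightarrow> 'p set" where
  "Omega3 P = {z \<in> carrier P. {0} \<subset> Ev_ad P z \<and> D_ad P z \<subset> F_ad P z \<and> F_ad P z = carrier P}"

definition Omega3' :: "('k::field, 'p) poisson \<Rightarrow> 'p set" where
  "Omega3' P = {z \<in> carrier P. {0} \<subset> Ev_ad P z \<and> D_ad P z \<subset> F_ad P z \<and> F_ad P z \<subset> carrier P}"


section \<open>Tensor products\<close>

text \<open>
  \<open>P\<^sub>1 \<otimes> P\<^sub>2\<close> is the free vector space on \<open>P\<^sub>1 \<times> P\<^sub>2\<close> (finitely supported coefficient functions)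
  modulo the subspace spanned by the bilinearity relations.  Product and bracket are first given on
  the free vector space by bilinear extension from the basis \<open>P\<^sub>1 \<times> P\<^sub>2\<close>.
\<close>

definition free_smult :: "'k::field \<Rightarrow> ('i \<Rightarrow>\<^sub>0 'k) \<Rightarrow> ('i \<Rightarrow>\<^sub>0 'k)" where
  "free_smult c f = Poly_Mapping.map ((*) c) f"

definition bilinear_ext ::
  "('i \<Rightarrow> 'i \<Rightarrow> ('i \<Rightarrow>\<^sub>0 'k::field)) \<Rightarrow> ('i \<Rightarrow>\<^sub>0 'k) \<Rightarrow> ('i \<Rightarrow>\<^sub>0 'k) \<Rightarrow> ('i \<Rightarrow>\<^sub>0 'k)" where
  "bilinear_ext b f g =
     (\<Sum>p\<in>Poly_Mapping.keys f. \<Sum>q\<in>Poly_Mapping.keys g.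
        free_smult (Poly_Mapping.lookup f p * Poly_Mapping.lookup g q) (b p q))"

definition free_mult ::
  "('k::field, 'p) poisson \<Rightarrow> ('k, 'q) poisson \<Rightarrow>
   ('p \<times> 'q \<Rightarrow>\<^sub>0 'k) \<Rightarrow> ('p \<times> 'q \<Rightarrow>\<^sub>0 'k) \<Rightarrow> ('p \<times> 'q \<Rightarrow>\<^sub>0 'k)" where
  "free_mult P1 P2 =
     bilinear_ext (\<lambda>(a1, a2) (b1, b2). Poly_Mapping.single (a1 \<otimes>\<^bsub>P1\<^esub> b1, a2 \<otimes>\<^bsub>P2\<^esub> b2) 1)"

text \<open>The commutator is used unless both factors are commutative.\<close>

definition free_bracket ::
  "('k::field, 'p) poisson \<Rightarrow> ('k, 'q) poisson \<Rightarrow>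
   ('p \<times> 'q \<Rightarrow>\<^sub>0 'k) \<Rightarrow> ('p \<times> 'q \<Rightarrow>\<^sub>0 'k) \<Rightarrow> ('p \<times> 'q \<Rightarrow>\<^sub>0 'k)" where
  "free_bracket P1 P2 =
     (if class1 P1 \<and> class1 P2
      then bilinear_ext (\<lambda>(a1, a2) (b1, b2).
             Poly_Mapping.single (bracket P1 a1 b1, a2 \<otimes>\<^bsub>P2\<^esub> b2) 1
           + Poly_Mapping.single (b1 \<otimes>\<^bsub>P1\<^esub> a1, bracket P2 a2 b2) 1)
      else (\<lambda>f g. free_mult P1 P2 f g - free_mult P1 P2 g f))"

text \<open>The bracket of this record satisfies the Poisson axioms only modulo the relations.\<close>

definition free_product ::
  "('k::field, 'p) poisson \<Rightarrow> ('k, 'q) poisson \<Rightarrow> ('k, 'p \<times> 'q \<Rightarrow>\<^sub>0 'k) poisson" where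
  "free_product P1 P2 =
     \<lparr>carrier = {f. Poly_Mapping.keys f \<subseteq> carrier P1 \<times> carrier P2},
      mult = free_mult P1 P2,
      one = Poly_Mapping.single (\<one>\<^bsub>P1\<^esub>, \<one>\<^bsub>P2\<^esub>) 1,
      zero = 0,
      add = (+),
      smult = free_smult,
      bracket = free_bracket P1 P2\<rparr>"

definition tensor_relators ::
  "('k::field, 'p) poisson \<Rightarrow> ('k, 'q) poisson \<Rightarrow> ('p \<times> 'q \<Rightarrow>\<^sub>0 'k) set" where
  "tensor_relators P1 P2 =
     {Poly_Mapping.single (x \<oplus>\<^bsub>P1\<^esub> y, b) 1 - Poly_Mapping.single (x, b) 1 - Poly_Mapping.single (y, b) 1
       | x y b. x \<in> carrier P1 \<and> y \<in> carrier P1 \<and> b \<in> carrier P2} \<union>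
     {Poly_Mapping.single (a, x \<oplus>\<^bsub>P2\<^esub> y) 1 - Poly_Mapping.single (a, x) 1 - Poly_Mapping.single (a, y) 1
       | a x y. a \<in> carrier P1 \<and> x \<in> carrier P2 \<and> y \<in> carrier P2} \<union>
     {Poly_Mapping.single (c \<odot>\<^bsub>P1\<^esub> a, b) 1 - Poly_Mapping.single (a, b) c
       | c a b. a \<in> carrier P1 \<and> b \<in> carrier P2} \<union>
     {Poly_Mapping.single (a, c \<odot>\<^bsub>P2\<^esub> b) 1 - Poly_Mapping.single (a, b) c
       | c a b. a \<in> carrier P1 \<and> b \<in> carrier P2}"

definition tensor_relations ::
  "('k::field, 'p) poisson \<Rightarrow> ('k, 'q) poisson \<Rightarrow> ('p \<times> 'q \<Rightarrow>\<^sub>0 'k) set" where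
  "tensor_relations P1 P2 = span_of (free_product P1 P2) (tensor_relators P1 P2)"

text \<open>
  The relations form a two-sided ideal of the free product, so the ring structure is the library's
  quotient ring.  Scalar multiplication and bracket of cosets follow the pattern of
  \<open>rcoset_mult\<close>: the union over all representatives is a single coset.
\<close>

definition tensor_product ::
  "('k::field, 'p) poisson \<Rightarrow> ('k, 'q) poisson \<Rightarrow> ('k, ('p \<times> 'q \<Rightarrow>\<^sub>0 'k) set) poisson" where
  "tensor_product P1 P2 =
     (let E = free_product P1 P2; I = tensor_relations P1 P2 in
      \<lparr>carrier = carrier (E Quot I),
       mult = mult (E Quot I),
       one = one (E Quot I),
       zero = zero (E Quot I),
       add = add (E Quot I),
       smult = (\<lambda>c X. \<Union>f\<in>X. I +>\<^bsub>E\<^esub> (c \<odot>\<^bsub>E\<^esub> f)),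
       bracket = (\<lambda>X Y. \<Union>f\<in>X. \<Union>g\<in>Y. I +>\<^bsub>E\<^esub> bracket E f g)\<rparr>)"

definition pure_tensor ::
  "('k::field, 'p) poisson \<Rightarrow> ('k, 'q) poisson \<Rightarrow> 'p \<Rightarrow> 'q \<Rightarrow> ('p \<times> 'q \<Rightarrow>\<^sub>0 'k) set" where
  "pure_tensor P1 P2 a b =
     tensor_relations P1 P2 +>\<^bsub>free_product P1 P2\<^esub> Poly_Mapping.single (a, b) 1"

text \<open>For subspaces \<open>A\<close> of \<open>P\<^sub>1\<close> and \<open>B\<close> of \<open>P\<^sub>2\<close>, the subspace \<open>A \<otimes> B\<close> of \<open>P\<^sub>1 \<otimes> P\<^sub>2\<close>.\<close>

definition tensor_subspace ::
  "('k::field, 'p) poisson \<Rightarrow> ('k, 'q) poisson \<Rightarrow> 'p set \<Rightarrow> 'q set \<Rightarrow> ('p \<times> 'q \<Rightarrow>\<^sub>0 'k) set set" where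
  "tensor_subspace P1 P2 A B =
     span_of (tensor_product P1 P2) {pure_tensor P1 P2 a b | a b. a \<in> A \<and> b \<in> B}"

end

theory Submission
  imports Defs
begin

text \<open>
  The adjoint action of \<open>\<Gamma>\<close> on \<open>P\<^sub>1 \<otimes> P\<^sub>2\<close> is \<open>ad z\<^sub>1 \<otimes> 1 + 1 \<otimes> ad z\<^sub>2\<close>, and the rest is linear algebra.
  Contracting one factor of a tensor \<open>w\<close> with a linear form gives an element of the other factor.
  For \<open>w \<in> F(\<Gamma>)\<close>, the contractions into \<open>P\<^sub>1\<close> of all iterates of \<open>w\<close> span a finite-dimensional
  \<open>ad z\<^sub>1\<close>-stable subspace, since contracting \<open>ad \<Gamma> w\<close> with \<open>f\<close> gives \<open>ad z\<^sub>1\<close> of the contraction of \<open>w\<close> with \<open>f\<close>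
  plus the contraction of \<open>w\<close> with \<open>f \<circ> ad z\<^sub>2\<close>.  So all of them lie in \<open>F(z\<^sub>1) = C(z\<^sub>1)\<close>, that is,
  \<open>F(\<Gamma>) \<subseteq> C(z\<^sub>1) \<otimes> P\<^sub>2\<close>.  There \<open>ad \<Gamma>\<close> acts as \<open>1 \<otimes> ad z\<^sub>2\<close> and commutes with the contractions into
  \<open>P\<^sub>2\<close>, which reduces each claim about \<open>\<Gamma>\<close> to the same claim about \<open>z\<^sub>2\<close>.
\<close>

section \<open>Subspaces attached to the adjoint action\<close>

text \<open>A coset of formal sums does not show whether it lies in A \<otimes> P2, since its
  representatives are far from unique. Testing membership by all contractions avoids a choice of
  bases. It needs enough linear forms (a vector can be separated from a subspace) and a contraction
  for each form, which is where the universal property of the tensor product enters. The linear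
  algebra sees only this interface, so the quotient construction and the two bracket formulas stay
  out of it.

  The types need more than the four equalities: strict inclusions between subspaces of P2 must
  survive tensoring with C(z1). They do because C(z1) contains the unit, which is nonzero since
  C(z1) is a proper subspace of P1. Moreover, for a outside C(z1) and b nonzero, a \<otimes> b is
  outside F(\<Gamma>). So F(\<Gamma>) is proper even when F(z2) = P2, which is why the primed and
  the unprimed type of z2 both give a primed type for \<Gamma>.\<close>

text \<open>Lets the finite spanning set leave \<open>W\<close>. By the exchange property
  \<open>card B\<close> bounds every independent subset of \<open>W\<close>, so a maximal
  independent subset exists, and it generates \<open>W\<close>.\<close>

lemma (in vectorspace) fin_dim_submodule_iff:
  assumes W: "submodule K W V"
  shows "vectorspace.fin_dim K (vs W) \<longleftrightarrow> (\<exists>B. finite B \<and> B \<subseteq> carrier V \<and> W \<subseteq> span B)"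
proof -
  have "vectorspace K (vs W)"
    using submodule_is_module[OF W] field_axioms by (simp add: vectorspace_def)
  then interpret W: vectorspace K "vs W" .
  have WV: "W \<subseteq> carrier V" using W by (simp add: submodule_def)
  show ?thesis
  proof
    assume W.fin_dim
    then obtain A where A: "finite A" "A \<subseteq> W" "W.span A = W"
      unfolding W.fin_dim_def by auto
    then have "span A = W" using span_li_not_depend(1)[OF \<open>A \<subseteq> W\<close> W] by simp
    then show "\<exists>B. finite B \<and> B \<subseteq> carrier V \<and> W \<subseteq> span B" using A WV by blast
  next
    assume "\<exists>B. finite B \<and> B \<subseteq> carrier V \<and> W \<subseteq> span B"
    then obtain B where B: "finite B" "B \<subseteq> carrier V" "W \<subseteq> span B" by blast
    have card_le: "card A \<le> card B" if A: "finite A" "A \<subseteq> W" "lin_indpt A" for A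
    proof -
      have "A \<subseteq> span B" using A B by auto
      then have "\<exists>C \<subseteq> carrier V. int (card C) \<le> int (card B) - int (card A)"
        using replacement[OF \<open>finite A\<close> B(1) B(2) A(3)] by blast
      then show ?thesis by auto
    qed
    have bound: "finite A \<and> card A \<le> card B" if A: "A \<subseteq> carrier (vs W) \<and> W.lin_indpt A" for A
    proof -
      have A': "A \<subseteq> W" "lin_indpt A" using A span_li_not_depend(2)[OF _ W] by auto
      have "finite A"
      proof (rule ccontr)
        assume "infinite A"
        then obtain C where C: "C \<subseteq> A" "finite C" "card C = Suc (card B)"
          by (metis infinite_arbitrarily_large)
        then have "card C \<le> card B"
          using card_le[of C] A' subset_li_is_li[of A C] by auto
        then show False using C by simp
      qed
      then show ?thesis using A' card_le by blast
    qed
    have "W.lin_indpt {}" unfolding W.lin_dep_def by auto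
    then obtain A where "finite A" "maximal A (\<lambda>S. S \<subseteq> carrier (vs W) \<and> W.lin_indpt S)"
      using maximal_exists[of "\<lambda>S. S \<subseteq> carrier (vs W) \<and> W.lin_indpt S" "card B" "{}"] bound by auto
    then show W.fin_dim
      using W.max_li_is_gen unfolding W.fin_dim_def maximal_def by blast
  qed
qed

lemma (in Module.module) span_induct:
  assumes "x \<in> span S" "S \<subseteq> carrier M"
    and gen: "\<And>x. x \<in> S \<Longrightarrow> Q x"
    and zero: "Q \<zero>\<^bsub>M\<^esub>"
    and add: "\<And>x y. x \<in> carrier M \<Longrightarrow> y \<in> carrier M \<Longrightarrow> Q x \<Longrightarrow> Q y \<Longrightarrow> Q (x \<oplus>\<^bsub>M\<^esub> y)"
    and smult: "\<And>c x. c \<in> carrier R \<Longrightarrow> x \<in> carrier M \<Longrightarrow> Q x \<Longrightarrow> Q (c \<odot>\<^bsub>M\<^esub> x)"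
  shows "Q x"
proof -
  have "submodule R {x \<in> carrier M. Q x} M"
    using zero add smult by (intro submodule.intro module_axioms) auto
  then have "span S \<subseteq> {x \<in> carrier M. Q x}"
    using assms(2) gen by (intro span_is_subset) auto
  then show ?thesis using assms(1) by auto
qed

lemma submodule_minus_closed:
  assumes N: "submodule R N M" and x: "x \<in> N" and y: "y \<in> N"
  shows "x \<ominus>\<^bsub>M\<^esub> y \<in> N"
proof -
  interpret M: Module.module R M by (rule submodule.module[OF N])
  have "y \<in> carrier M" using submodule.subset[OF N] y by auto
  then have "\<ominus>\<^bsub>M\<^esub> y = (\<ominus>\<^bsub>R\<^esub> \<one>\<^bsub>R\<^esub>) \<odot>\<^bsub>M\<^esub> y"
    using M.smult_minus_1 by simp
  moreover have "(\<ominus>\<^bsub>R\<^esub> \<one>\<^bsub>R\<^esub>) \<odot>\<^bsub>M\<^esub> y \<in> N"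
    using submodule.smult_closed[OF N _ y] by simp
  ultimately show ?thesis
    unfolding a_minus_def using submodule.m_closed[OF N x] by metis
qed

text \<open>The scalars form a whole type, so the side conditions on the scalar carrier disappear
  from the module laws.\<close>

locale kspace = vectorspace "class_ring :: 'k::field ring" V
  for V :: "('k::field, 'v, 'm) module_scheme" (structure)
begin

lemma smult_zero_left [simp]: "x \<in> carrier V \<Longrightarrow> 0 \<odot> x = \<zero>"
  using lmult_0[of x] by simp

lemma smult_one_left [simp]: "x \<in> carrier V \<Longrightarrow> 1 \<odot> x = x"
  using smult_one[of x] by simp

lemma smult_smult: "x \<in> carrier V \<Longrightarrow> a \<odot> (b \<odot> x) = (a * b) \<odot> x"
  using smult_assoc1[of a b x] by simp

lemma smult_zero_right [simp]: "c \<odot> \<zero> = \<zero>"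
  using rmult_0[of c] by simp

lemma smult_minus_one: "x \<in> carrier V \<Longrightarrow> (-1) \<odot> x = \<ominus> x"
  using smult_minus_1[of x] by (simp add: class_ring_simps)

lemma smult_closed' [simp, intro]: "x \<in> carrier V \<Longrightarrow> c \<odot> x \<in> carrier V"
  using smult_closed[of c x] by simp

end

text \<open>Linearity of \<open>ad P z\<close> is all that the subspaces F, N, C and D require to be
  studied. In this form the results apply to the factors and to the tensor product alike.\<close>

locale ad_linear = kspace P
  for P :: "('k::field, 'p) poisson" (structure) and z :: 'p +
  assumes ad_hom: "ad P z \<in> LinearCombinations.module_hom class_ring P P"
begin

lemma ad_closed [simp, intro]: "x \<in> carrier P \<Longrightarrow> ad P z x \<in> carrier P"
  using LinearCombinations.module_hom_closed[OF ad_hom] by auto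

lemma ad_add: "x \<in> carrier P \<Longrightarrow> y \<in> carrier P \<Longrightarrow> ad P z (x \<oplus> y) = ad P z x \<oplus> ad P z y"
  using LinearCombinations.module_hom_add[OF ad_hom] .

lemma ad_smult: "x \<in> carrier P \<Longrightarrow> ad P z (c \<odot> x) = c \<odot> ad P z x"
  using LinearCombinations.module_hom_smult[OF ad_hom, of c x] by simp

lemma ad_zero [simp]: "ad P z \<zero> = \<zero>"
  using ad_smult[of \<zero> 0] by simp

lemma ad_pow_closed [simp, intro]: "x \<in> carrier P \<Longrightarrow> (ad P z ^^ n) x \<in> carrier P"
  by (induction n) auto

lemma ad_pow_add:
  "x \<in> carrier P \<Longrightarrow> y \<in> carrier P \<Longrightarrow> (ad P z ^^ n) (x \<oplus> y) = (ad P z ^^ n) x \<oplus> (ad P z ^^ n) y"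
  by (induction n) (auto simp: ad_add)

lemma ad_pow_smult: "x \<in> carrier P \<Longrightarrow> (ad P z ^^ n) (c \<odot> x) = c \<odot> (ad P z ^^ n) x"
  by (induction n) (auto simp: ad_smult)

lemma ad_pow_zero [simp]: "(ad P z ^^ n) \<zero> = \<zero>"
  by (induction n) auto

lemma orbit_space_ad_submodule:
  "x \<in> carrier P \<Longrightarrow> submodule class_ring (orbit_space_ad P z x) P"
  unfolding orbit_space_ad_def by (rule span_is_submodule) auto

text \<open>Since \<open>B\<close> may be any finite subset of the carrier, a witness is transported
  along a linear map simply by taking its image.\<close>

lemma F_ad_iff:
  assumes x: "x \<in> carrier P"
  shows "x \<in> F_ad P z \<longleftrightarrow>
    (\<exists>B. finite B \<and> B \<subseteq> carrier P \<and> (\<forall>n. (ad P z ^^ n) x \<in> span B))"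
proof -
  have "orbit_space_ad P z x \<subseteq> span B \<longleftrightarrow> (\<forall>n. (ad P z ^^ n) x \<in> span B)"
    if "B \<subseteq> carrier P" for B
  proof
    assume "orbit_space_ad P z x \<subseteq> span B"
    then show "\<forall>n. (ad P z ^^ n) x \<in> span B"
      using in_own_span[of "{(ad P z ^^ n) x |n. True}"] x unfolding orbit_space_ad_def by fastforce
  next
    assume "\<forall>n. (ad P z ^^ n) x \<in> span B"
    then show "orbit_space_ad P z x \<subseteq> span B"
      unfolding orbit_space_ad_def using that by (intro span_is_subset span_is_submodule) auto
  qed
  then show ?thesis
    unfolding F_ad_def using x fin_dim_submodule_iff[OF orbit_space_ad_submodule[OF x]] by auto
qed

lemma F_ad_submodule: "submodule class_ring (F_ad P z) P"
proof (intro submodule.intro module_axioms)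
  show "F_ad P z \<subseteq> carrier P" by (auto simp: F_ad_def)
next
  fix v w assume vw: "v \<in> F_ad P z" "w \<in> F_ad P z"
  then have c: "v \<in> carrier P" "w \<in> carrier P" by (auto simp: F_ad_def)
  obtain A B where A: "finite A" "A \<subseteq> carrier P" "\<And>n. (ad P z ^^ n) v \<in> span A"
    and B: "finite B" "B \<subseteq> carrier P" "\<And>n. (ad P z ^^ n) w \<in> span B"
    using vw c F_ad_iff by metis
  have "submodule class_ring (span (A \<union> B)) P" using A B by (intro span_is_submodule) auto
  moreover have "(ad P z ^^ n) v \<in> span (A \<union> B)" "(ad P z ^^ n) w \<in> span (A \<union> B)" for n
    using A(3) B(3) span_is_monotone[of A "A \<union> B"] span_is_monotone[of B "A \<union> B"] by auto
  ultimately have "(ad P z ^^ n) (v \<oplus> w) \<in> span (A \<union> B)" for n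
    using c by (simp add: ad_pow_add submodule.m_closed)
  then show "v \<oplus> w \<in> F_ad P z"
    using A B c by (subst F_ad_iff) (auto intro!: exI[of _ "A \<union> B"])
next
  show "\<zero> \<in> F_ad P z"
    by (subst F_ad_iff) (auto intro!: exI[of _ "{}"] submodule.zero_closed span_is_submodule)
next
  fix c :: 'k and v assume v: "v \<in> F_ad P z"
  then have vc: "v \<in> carrier P" by (auto simp: F_ad_def)
  obtain A where A: "finite A" "A \<subseteq> carrier P" "\<And>n. (ad P z ^^ n) v \<in> span A"
    using v vc F_ad_iff by metis
  have "submodule class_ring (span A) P" using A by (intro span_is_submodule) auto
  then have "(ad P z ^^ n) (c \<odot> v) \<in> span A" for n
    using A vc by (simp add: ad_pow_smult submodule.smult_closed)
  then show "c \<odot> v \<in> F_ad P z"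
    using A vc by (subst F_ad_iff) auto
qed

lemma N_ad_submodule: "submodule class_ring (N_ad P z) P"
proof (intro submodule.intro module_axioms)
  show "N_ad P z \<subseteq> carrier P" by (auto simp: N_ad_def)
next
  fix v w assume vw: "v \<in> N_ad P z" "w \<in> N_ad P z"
  then obtain m n where mn: "v \<in> carrier P" "w \<in> carrier P" "(ad P z ^^ m) v = \<zero>" "(ad P z ^^ n) w = \<zero>"
    by (auto simp: N_ad_def)
  \<comment> \<open>The order of the summands matters for \<open>funpow_add\<close>: the power that
    already kills the vector has to be applied first.\<close>
  have "(ad P z ^^ (n + m)) v = \<zero>" "(ad P z ^^ (m + n)) w = \<zero>"
    unfolding funpow_add using mn by auto
  then have "(ad P z ^^ (m + n)) (v \<oplus> w) = \<zero>"
    using mn by (simp add: ad_pow_add add.commute)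
  then show "v \<oplus> w \<in> N_ad P z" using mn by (auto simp: N_ad_def)
next
  fix c :: 'k and v assume "v \<in> N_ad P z"
  then obtain m where "v \<in> carrier P" "(ad P z ^^ m) v = \<zero>" by (auto simp: N_ad_def)
  then show "c \<odot> v \<in> N_ad P z" by (auto simp: N_ad_def ad_pow_smult intro!: exI[of _ m])
qed (auto simp: N_ad_def)

lemma C_ad_submodule: "submodule class_ring (C_ad P z) P"
  by (intro submodule.intro module_axioms) (auto simp: C_ad_def ad_add ad_smult)

lemma eigenspace_ad_submodule: "submodule class_ring (eigenspace_ad P z l) P"
  by (intro submodule.intro module_axioms)
    (auto simp: eigenspace_ad_def ad_add ad_smult smult_r_distr smult_smult mult.commute[of l])

lemma D_ad_submodule: "submodule class_ring (D_ad P z) P"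
  unfolding D_ad_def by (rule span_is_submodule) (auto simp: eigenspace_ad_def)

lemma ad_pow_eigen:
  "x \<in> eigenspace_ad P z l \<Longrightarrow> (ad P z ^^ n) x = l ^ n \<odot> x"
  by (induction n)
    (auto simp: eigenspace_ad_def ad_smult smult_smult mult.commute[of l])

text \<open>Valid for every scalar: if \<open>l\<close> is not an eigenvalue, the eigenspace is
  zero. Later arguments can thus range over all \<open>l\<close> without checking membership in
  \<open>Ev_ad\<close>.\<close>

lemma eigenspace_ad_subset_D_ad: "eigenspace_ad P z l \<subseteq> D_ad P z"
proof
  fix x assume x: "x \<in> eigenspace_ad P z l"
  show "x \<in> D_ad P z"
  proof (cases "x = \<zero>")
    case True
    then show ?thesis using D_ad_submodule by (simp add: submodule.zero_closed)
  next
    case False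
    then have "l \<in> Ev_ad P z" using x by (auto simp: Ev_ad_def eigenspace_ad_def)
    moreover have "(\<Union>l\<in>Ev_ad P z. eigenspace_ad P z l) \<subseteq> D_ad P z"
      unfolding D_ad_def by (rule in_own_span) (auto simp: eigenspace_ad_def)
    ultimately show ?thesis using x by auto
  qed
qed

lemma D_ad_subset:
  assumes "submodule class_ring N P" "\<And>l. eigenspace_ad P z l \<subseteq> N"
  shows "D_ad P z \<subseteq> N"
  unfolding D_ad_def using assms by (intro span_is_subset) auto

lemma eigenspace_ad_subset_F_ad: "eigenspace_ad P z l \<subseteq> F_ad P z"
proof
  fix x assume x: "x \<in> eigenspace_ad P z l"
  then have xc: "x \<in> carrier P" by (simp add: eigenspace_ad_def)
  have "submodule class_ring (span {x}) P" "x \<in> span {x}"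
    using xc in_own_span[of "{x}"] by (auto intro: span_is_submodule)
  then have "(ad P z ^^ n) x \<in> span {x}" for n
    using x by (simp add: ad_pow_eigen submodule.smult_closed)
  then show "x \<in> F_ad P z" using xc by (subst F_ad_iff) (auto intro!: exI[of _ "{x}"])
qed

lemma N_ad_subset_F_ad: "N_ad P z \<subseteq> F_ad P z"
proof
  fix x assume "x \<in> N_ad P z"
  then obtain m where x: "x \<in> carrier P" and m: "(ad P z ^^ m) x = \<zero>" by (auto simp: N_ad_def)
  let ?B = "(\<lambda>n. (ad P z ^^ n) x) ` {..m}"
  have B: "?B \<subseteq> span ?B" using x by (intro in_own_span) auto
  have "(ad P z ^^ n) x \<in> span ?B" for n
  proof (cases "n \<le> m")
    case False
    then have "(ad P z ^^ n) x = (ad P z ^^ (n - m)) ((ad P z ^^ m) x)"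
      by (metis comp_apply funpow_add le_add_diff_inverse2 nat_le_linear)
    then show ?thesis using m B x by (simp add: submodule.zero_closed[OF span_is_submodule] image_subset_iff)
  qed (use B in auto)
  then show "x \<in> F_ad P z" using x by (subst F_ad_iff) (auto intro!: exI[of _ ?B])
qed

lemma C_ad_eq_eigenspace: "C_ad P z = eigenspace_ad P z 0"
  by (auto simp: C_ad_def eigenspace_ad_def)

lemma C_ad_subset_N_ad: "C_ad P z \<subseteq> N_ad P z"
  by (auto simp: C_ad_def N_ad_def intro: exI[of _ 1])

end

section \<open>Free vector spaces and linear forms\<close>

lemma lookup_free_smult [simp]:
  "Poly_Mapping.lookup (free_smult c h) p = c * Poly_Mapping.lookup h p"
  by (simp add: free_smult_def Poly_Mapping.map.rep_eq when_def)

lemma keys_free_smult: "Poly_Mapping.keys (free_smult c h) \<subseteq> Poly_Mapping.keys h"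
  by (auto simp: in_keys_iff)

lemma free_smult_single [simp]:
  "free_smult c (Poly_Mapping.single p d) = Poly_Mapping.single p (c * d)"
  by (rule poly_mapping_eqI) (simp add: lookup_single when_def)

lemma vector_space_free_smult:
  "vector_space (free_smult :: 'k::field \<Rightarrow> ('i \<Rightarrow>\<^sub>0 'k) \<Rightarrow> ('i \<Rightarrow>\<^sub>0 'k))"
  by unfold_locales (auto intro!: poly_mapping_eqI simp: lookup_add algebra_simps)

interpretation free: vector_space "free_smult :: 'k::field \<Rightarrow> ('i \<Rightarrow>\<^sub>0 'k) \<Rightarrow> ('i \<Rightarrow>\<^sub>0 'k)"
  by (rule vector_space_free_smult)

interpretation free_pair: vector_space_pair
    "free_smult :: 'k::field \<Rightarrow> ('i \<Rightarrow>\<^sub>0 'k) \<Rightarrow> ('i \<Rightarrow>\<^sub>0 'k)" "(*) :: 'k \<Rightarrow> 'k \<Rightarrow> 'k"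
  by unfold_locales (auto simp: algebra_simps)

lemma poly_mapping_keys_induct [consumes 1, case_names zero single add]:
  fixes h :: "'i \<Rightarrow>\<^sub>0 'k::comm_monoid_add"
  assumes "Poly_Mapping.keys h \<subseteq> X"
    and zero: "Q 0"
    and single: "\<And>p c. p \<in> X \<Longrightarrow> Q (Poly_Mapping.single p c)"
    and add: "\<And>f g. Poly_Mapping.keys f \<subseteq> X \<Longrightarrow> Poly_Mapping.keys g \<subseteq> X \<Longrightarrow> Q f \<Longrightarrow> Q g \<Longrightarrow> Q (f + g)"
  shows "Q h"
  using assms(1)
proof (induction h rule: update_induct)
  case const
  show ?case by (rule zero)
next
  case (update f a b)
  have eq: "Poly_Mapping.update a b f = f + Poly_Mapping.single a b"
    using update(1) by (intro poly_mapping_eqI) (auto simp: lookup_update lookup_add lookup_single when_def in_keys_iff)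
  have "a \<in> Poly_Mapping.keys (Poly_Mapping.update a b f)"
    using update(2) by (simp add: in_keys_iff lookup_update)
  moreover have "Poly_Mapping.keys f \<subseteq> Poly_Mapping.keys (Poly_Mapping.update a b f)"
    using update(1) by (auto simp: in_keys_iff lookup_update)
  ultimately have "a \<in> X" "Poly_Mapping.keys f \<subseteq> X" using update.prems by auto
  then show ?case unfolding eq using update.IH single
    by (intro add) (auto simp: keys_single)
qed

text \<open>The universal property of the free vector space on \<open>X\<close>, with a target given
  by a carrier. It yields the evaluation map of a space on formal sums of its own vectors, and the
  maps out of the tensor product.\<close>

lemma linear_extension_from_free:
  fixes V :: "('k::field, 'v, 'm) module_scheme" and b :: "'i \<Rightarrow> 'v"
  assumes "Module.module class_ring V" and b: "\<And>p. p \<in> X \<Longrightarrow> b p \<in> carrier V"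
  obtains L where
    "\<And>h. Poly_Mapping.keys h \<subseteq> X \<Longrightarrow> L h \<in> carrier V"
    "\<And>h h'. Poly_Mapping.keys h \<subseteq> X \<Longrightarrow> Poly_Mapping.keys h' \<subseteq> X \<Longrightarrow> L (h + h') = L h \<oplus>\<^bsub>V\<^esub> L h'"
    "\<And>c h. Poly_Mapping.keys h \<subseteq> X \<Longrightarrow> L (free_smult c h) = c \<odot>\<^bsub>V\<^esub> L h"
    "\<And>p c. p \<in> X \<Longrightarrow> L (Poly_Mapping.single p c) = c \<odot>\<^bsub>V\<^esub> b p"
proof -
  interpret V: Module.module class_ring V by fact
  define L where "L h = (\<Oplus>\<^bsub>V\<^esub>p\<in>Poly_Mapping.keys h. Poly_Mapping.lookup h p \<odot>\<^bsub>V\<^esub> b p)" for h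
  have smult_closed: "c \<odot>\<^bsub>V\<^esub> b p \<in> carrier V" if "p \<in> X" for c p
    using V.smult_closed[of c "b p"] b[OF that] by simp
  have zero: "0 \<odot>\<^bsub>V\<^esub> v = \<zero>\<^bsub>V\<^esub>" if "v \<in> carrier V" for v
    using V.smult_l_null[OF that] by simp
  \<comment> \<open>Keys can cancel in \<open>h + h'\<close>, so the sums have to be compared over a
    common finite index set.\<close>
  have L_eq: "L h = (\<Oplus>\<^bsub>V\<^esub>p\<in>A. Poly_Mapping.lookup h p \<odot>\<^bsub>V\<^esub> b p)"
    if A: "finite A" "Poly_Mapping.keys h \<subseteq> A" "A \<subseteq> X" for h A
    unfolding L_def using A b zero
    by (intro V.M.add.finprod_mono_neutral_cong_left) (auto simp: in_keys_iff intro!: smult_closed)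
  show ?thesis
  proof
    fix h h' :: "'i \<Rightarrow>\<^sub>0 'k" and c :: 'k
    assume h: "Poly_Mapping.keys h \<subseteq> X"
    show "L h \<in> carrier V"
      unfolding L_def using h by (intro V.M.finsum_closed) (auto intro!: smult_closed)
    have "L (free_smult c h) = (\<Oplus>\<^bsub>V\<^esub>p\<in>Poly_Mapping.keys h. c \<odot>\<^bsub>V\<^esub> (Poly_Mapping.lookup h p \<odot>\<^bsub>V\<^esub> b p))"
      using h keys_free_smult[of c h] b V.smult_assoc1[of c]
      by (subst L_eq[of "Poly_Mapping.keys h"])
        (auto intro!: V.M.finsum_cong' smult_closed V.smult_closed)
    also have "\<dots> = c \<odot>\<^bsub>V\<^esub> L h"
      unfolding L_def using h by (intro V.finsum_smult_ldistr[symmetric]) (auto intro!: smult_closed)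
    finally show "L (free_smult c h) = c \<odot>\<^bsub>V\<^esub> L h" .
    assume h': "Poly_Mapping.keys h' \<subseteq> X"
    let ?A = "Poly_Mapping.keys h \<union> Poly_Mapping.keys h'"
    have "L (h + h') = (\<Oplus>\<^bsub>V\<^esub>p\<in>?A. Poly_Mapping.lookup h p \<odot>\<^bsub>V\<^esub> b p \<oplus>\<^bsub>V\<^esub> Poly_Mapping.lookup h' p \<odot>\<^bsub>V\<^esub> b p)"
      using h h' keys_add[of h h'] b V.smult_l_distr
      by (subst L_eq[of ?A]) (auto intro!: V.M.finsum_cong' V.M.add.m_closed smult_closed simp: lookup_add)
    also have "\<dots> = (\<Oplus>\<^bsub>V\<^esub>p\<in>?A. Poly_Mapping.lookup h p \<odot>\<^bsub>V\<^esub> b p) \<oplus>\<^bsub>V\<^esub>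
        (\<Oplus>\<^bsub>V\<^esub>p\<in>?A. Poly_Mapping.lookup h' p \<odot>\<^bsub>V\<^esub> b p)"
      using h h' by (intro V.M.finsum_addf) (auto intro!: smult_closed)
    also have "\<dots> = L h \<oplus>\<^bsub>V\<^esub> L h'"
      using h h' L_eq[of ?A h] L_eq[of ?A h'] by simp
    finally show "L (h + h') = L h \<oplus>\<^bsub>V\<^esub> L h'" .
  next
    fix p :: 'i and c :: 'k
    assume p: "p \<in> X"
    then have "L (Poly_Mapping.single p c) = (\<Oplus>\<^bsub>V\<^esub>q\<in>{p}. Poly_Mapping.lookup (Poly_Mapping.single p c) q \<odot>\<^bsub>V\<^esub> b q)"
      by (intro L_eq) auto
    then show "L (Poly_Mapping.single p c) = c \<odot>\<^bsub>V\<^esub> b p"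
      using p smult_closed[OF p] by (simp add: V.M.finsum_insert)
  qed
qed

definition linear_form :: "('k::field, 'v, 'm) module_scheme \<Rightarrow> ('v \<Rightarrow> 'k) \<Rightarrow> bool" where
  "linear_form V f \<longleftrightarrow>
     (\<forall>x\<in>carrier V. \<forall>y\<in>carrier V. f (x \<oplus>\<^bsub>V\<^esub> y) = f x + f y) \<and>
     (\<forall>c. \<forall>x\<in>carrier V. f (c \<odot>\<^bsub>V\<^esub> x) = c * f x)"

text \<open>The carrier need not be a whole type, so the form is constructed on the free vector space over
  the carrier, where type-based results on bases apply.\<close>

lemma linear_form_separates:
  fixes V :: "('k::field, 'v, 'm) module_scheme"
  assumes N: "submodule class_ring N V" and x: "x \<in> carrier V" "x \<notin> N"
  obtains f where "linear_form V f" "\<And>y. y \<in> N \<Longrightarrow> f y = 0" "f x = 1"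
proof -
  interpret V: Module.module class_ring V by (rule submodule.module[OF N])
  obtain L where L_closed: "\<And>h. Poly_Mapping.keys h \<subseteq> carrier V \<Longrightarrow> L h \<in> carrier V"
    and L_add: "\<And>h h'. Poly_Mapping.keys h \<subseteq> carrier V \<Longrightarrow> Poly_Mapping.keys h' \<subseteq> carrier V \<Longrightarrow>
      L (h + h') = L h \<oplus>\<^bsub>V\<^esub> L h'"
    and L_smult: "\<And>c h. Poly_Mapping.keys h \<subseteq> carrier V \<Longrightarrow> L (free_smult c h) = c \<odot>\<^bsub>V\<^esub> L h"
    and L_single: "\<And>p c. p \<in> carrier V \<Longrightarrow> L (Poly_Mapping.single p c) = c \<odot>\<^bsub>V\<^esub> p"
    using linear_extension_from_free[OF V.module_axioms, of "carrier V" "\<lambda>p. p"] by blast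
  have one: "1 \<odot>\<^bsub>V\<^esub> y = y" if "y \<in> carrier V" for y
    using V.smult_one[OF that] by simp
  have closed: "c \<odot>\<^bsub>V\<^esub> y \<in> carrier V" if "y \<in> carrier V" for c y
    using V.smult_closed[of c y] that by simp
  have m1: "(-1) \<odot>\<^bsub>V\<^esub> y = \<ominus>\<^bsub>V\<^esub> y" if "y \<in> carrier V" for y
    using V.smult_minus_1[OF that] by (simp add: class_ring_simps)
  have zeroN: "\<zero>\<^bsub>V\<^esub> \<in> N" using N by (rule submodule.zero_closed)
  have L0: "L 0 = \<zero>\<^bsub>V\<^esub>"
    using L_single[OF x(1), of 0] V.smult_l_null[OF x(1)] by simp
  \<comment> \<open>\<open>S\<close> is the preimage of \<open>N\<close> under the evaluation map
    \<open>L\<close>, so it contains every formal relation that holds in \<open>V\<close>. A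
    functional vanishing on \<open>S\<close> therefore induces a form on \<open>V\<close> that
    vanishes on \<open>N\<close>.\<close>
  define S where "S = {h. Poly_Mapping.keys h \<subseteq> carrier V \<and> L h \<in> N}"
  have keys_plus: "Poly_Mapping.keys (h + h') \<subseteq> carrier V"
    if "Poly_Mapping.keys h \<subseteq> carrier V" "Poly_Mapping.keys h' \<subseteq> carrier V" for h h' :: "'v \<Rightarrow>\<^sub>0 'k"
    using that keys_add[of h h'] by blast
  have S: "free.subspace S"
  proof (rule free.subspaceI)
    show "0 \<in> S" using L0 zeroN by (simp add: S_def)
  next
    fix h k assume "h \<in> S" "k \<in> S"
    then show "h + k \<in> S"
      using keys_plus L_add submodule.m_closed[OF N] by (simp add: S_def)
  next
    fix c h assume "h \<in> S"
    then show "free_smult c h \<in> S"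
      using keys_free_smult[of c h] L_smult submodule.smult_closed[OF N] by (auto simp: S_def)
  qed
  obtain B where B: "B \<subseteq> S" "free.independent B" "S \<subseteq> free.span B"
    using free.maximal_independent_subset[of S] by blast
  have "free.span B \<subseteq> S" using B(1) S by (rule free.span_minimal)
  moreover have "Poly_Mapping.single x 1 \<notin> S"
    using x L_single[OF x(1), of 1] one by (simp add: S_def)
  ultimately have xB: "Poly_Mapping.single x 1 \<notin> free.span B" by blast
  then have "Poly_Mapping.single x 1 \<notin> B" using free.span_base by blast
  then have "free.independent (insert (Poly_Mapping.single x 1) B)"
    using B(2) xB by (simp add: free.independent_insert)
  then obtain g where g: "Vector_Spaces.linear free_smult (*) g"
    "\<forall>y\<in>insert (Poly_Mapping.single x 1) B. g y = (if y \<in> B then 0 else 1)"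
    using free_pair.linear_independent_extend[of "insert (Poly_Mapping.single x 1) B" "\<lambda>y. if y \<in> B then 0 else 1"]
    by blast
  have gS: "g y = 0" if "y \<in> S" for y
    using free_pair.linear_eq_0_on_span[OF g(1), of B y] g(2) B(3) that by auto
  have g_add: "g (h + h') = g h + g h'" for h h' using free_pair.linear_add[OF g(1)] .
  have g_smult: "g (free_smult c h) = c * g h" for c h using free_pair.linear_scale[OF g(1)] .
  have g_single: "g (Poly_Mapping.single y c) = c * g (Poly_Mapping.single y 1)" for y c
    using g_smult[of c "Poly_Mapping.single y 1"] by simp
  define f where "f y = g (Poly_Mapping.single y 1)" for y
  show thesis
  proof
    show "f x = 1" using g(2) \<open>Poly_Mapping.single x 1 \<notin> B\<close> by (simp add: f_def)
    show "f y = 0" if "y \<in> N" for y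
    proof -
      have "y \<in> carrier V" using that submodule.subset[OF N] by blast
      then show ?thesis
        unfolding f_def using that one L_single[of y 1] by (intro gS) (auto simp: S_def)
    qed
    show "linear_form V f"
      unfolding linear_form_def
    proof (intro conjI ballI allI)
      fix y z assume yz: "y \<in> carrier V" "z \<in> carrier V"
      \<comment> \<open>\<open>?h + ?k\<close> is the formal relation expressing additivity. It
        evaluates to zero, hence lies in \<open>S\<close>, and \<open>g\<close> kills it.\<close>
      let ?h = "Poly_Mapping.single y (1::'k) + Poly_Mapping.single z 1"
      let ?k = "Poly_Mapping.single (y \<oplus>\<^bsub>V\<^esub> z) (- 1 :: 'k)"
      have k: "Poly_Mapping.keys ?h \<subseteq> carrier V" "Poly_Mapping.keys ?k \<subseteq> carrier V"
        using yz keys_plus[of "Poly_Mapping.single y 1" "Poly_Mapping.single z 1"] by auto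
      have "L (?h + ?k) = (y \<oplus>\<^bsub>V\<^esub> z) \<oplus>\<^bsub>V\<^esub> \<ominus>\<^bsub>V\<^esub> (y \<oplus>\<^bsub>V\<^esub> z)"
        using yz k by (subst L_add) (auto simp: L_add L_single one m1)
      then have "?h + ?k \<in> S"
        unfolding S_def using keys_plus[OF k] yz zeroN by (simp add: V.M.r_neg)
      then have "g (?h + ?k) = 0" by (rule gS)
      then show "f (y \<oplus>\<^bsub>V\<^esub> z) = f y + f z"
        unfolding g_add f_def using g_single[of "y \<oplus>\<^bsub>V\<^esub> z" "-1"] by (simp add: add_eq_0_iff)
    next
      fix c y assume y: "y \<in> carrier V"
      let ?h = "Poly_Mapping.single (c \<odot>\<^bsub>V\<^esub> y) (1::'k)" and ?k = "Poly_Mapping.single y (-c)"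
      have k: "Poly_Mapping.keys ?h \<subseteq> carrier V" "Poly_Mapping.keys ?k \<subseteq> carrier V"
        using y closed by auto
      have "(c + - c) \<odot>\<^bsub>V\<^esub> y = c \<odot>\<^bsub>V\<^esub> y \<oplus>\<^bsub>V\<^esub> (- c) \<odot>\<^bsub>V\<^esub> y"
        using V.smult_l_distr[of c "- c" y] y by simp
      then have "L (?h + ?k) = \<zero>\<^bsub>V\<^esub>"
        using y k closed V.smult_l_null[OF y] by (subst L_add) (auto simp: L_single one)
      then have "?h + ?k \<in> S"
        unfolding S_def using keys_plus[OF k] zeroN by simp
      then have "g (?h + ?k) = 0" by (rule gS)
      then show "f (c \<odot>\<^bsub>V\<^esub> y) = c * f y"
        unfolding g_add f_def using g_single[of y "-c"] by (simp add: add_eq_0_iff)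
    qed
  qed
qed

section \<open>Contractions of tensors\<close>

text \<open>This is g \<otimes> id followed by the identification of K \<otimes> P2 with P2. As a
  predicate with the pure tensor map as a parameter, it also describes contractions into the other
  factor once the arguments of \<open>t\<close> are exchanged.\<close>

definition contraction ::
  "('k::field, 'p, 'm1) module_scheme \<Rightarrow> ('k, 'q, 'm2) module_scheme \<Rightarrow> ('k, 't, 'm3) module_scheme \<Rightarrow>
   ('p \<Rightarrow> 'q \<Rightarrow> 't) \<Rightarrow> ('p \<Rightarrow> 'k) \<Rightarrow> ('t \<Rightarrow> 'q) \<Rightarrow> bool" where
  "contraction P1 P2 T t g L \<longleftrightarrow> L \<in> LinearCombinations.module_hom class_ring T P2 \<and>
     (\<forall>a\<in>carrier P1. \<forall>b\<in>carrier P2. L (t a b) = g a \<odot>\<^bsub>P2\<^esub> b)"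

text \<open>Bilinearity and \<open>spanned\<close> alone would allow any quotient of the tensor
  product, even zero. The two contraction axioms exclude further relations and play the part of the
  universal property.\<close>

locale tensor_space =
  V1: kspace P1 + V2: kspace P2 + T: kspace T
  for P1 :: "('k::field, 'p, 'm1) module_scheme" and P2 :: "('k, 'q, 'm2) module_scheme"
    and T :: "('k, 't, 'm3) module_scheme" +
  fixes t :: "'p \<Rightarrow> 'q \<Rightarrow> 't"
  assumes t_closed [simp, intro]: "\<lbrakk>a \<in> carrier P1; b \<in> carrier P2\<rbrakk> \<Longrightarrow> t a b \<in> carrier T"
    and t_add_left: "\<lbrakk>a \<in> carrier P1; a' \<in> carrier P1; b \<in> carrier P2\<rbrakk> \<Longrightarrow>
      t (a \<oplus>\<^bsub>P1\<^esub> a') b = t a b \<oplus>\<^bsub>T\<^esub> t a' b"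
    and t_add_right: "\<lbrakk>a \<in> carrier P1; b \<in> carrier P2; b' \<in> carrier P2\<rbrakk> \<Longrightarrow>
      t a (b \<oplus>\<^bsub>P2\<^esub> b') = t a b \<oplus>\<^bsub>T\<^esub> t a b'"
    and t_smult_left: "\<lbrakk>a \<in> carrier P1; b \<in> carrier P2\<rbrakk> \<Longrightarrow> t (c \<odot>\<^bsub>P1\<^esub> a) b = c \<odot>\<^bsub>T\<^esub> t a b"
    and t_smult_right: "\<lbrakk>a \<in> carrier P1; b \<in> carrier P2\<rbrakk> \<Longrightarrow> t a (c \<odot>\<^bsub>P2\<^esub> b) = c \<odot>\<^bsub>T\<^esub> t a b"
    and spanned: "carrier T \<subseteq> T.span {t a b |a b. a \<in> carrier P1 \<and> b \<in> carrier P2}"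
    and contraction_left: "linear_form P1 g \<Longrightarrow> \<exists>L. contraction P1 P2 T t g L"
    and contraction_right: "linear_form P2 f \<Longrightarrow> \<exists>L. contraction P2 P1 T (\<lambda>b a. t a b) f L"
begin

text \<open>The axioms are symmetric in the two factors, so each result about left factors has a
  mirror image.\<close>

lemma tensor_space_swap: "tensor_space P2 P1 T (\<lambda>b a. t a b)"
proof -
  have "{t a b |a b. a \<in> carrier P1 \<and> b \<in> carrier P2} = {t a b |b a. b \<in> carrier P2 \<and> a \<in> carrier P1}"
    by blast
  then show ?thesis
    using spanned t_closed t_add_left t_add_right t_smult_left t_smult_right
      contraction_left contraction_right
    by unfold_locales auto
qed

definition tens :: "'p set \<Rightarrow> 'q set \<Rightarrow> 't set" where
  "tens A B = T.span {t a b |a b. a \<in> A \<and> b \<in> B}"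

lemma t_zero_left [simp]: "b \<in> carrier P2 \<Longrightarrow> t \<zero>\<^bsub>P1\<^esub> b = \<zero>\<^bsub>T\<^esub>"
  using t_smult_left[of "\<zero>\<^bsub>P1\<^esub>" b 0] by simp

lemma t_zero_right [simp]: "a \<in> carrier P1 \<Longrightarrow> t a \<zero>\<^bsub>P2\<^esub> = \<zero>\<^bsub>T\<^esub>"
  using t_smult_right[of a "\<zero>\<^bsub>P2\<^esub>" 0] by simp

lemma generators_closed:
  "\<lbrakk>A \<subseteq> carrier P1; B \<subseteq> carrier P2\<rbrakk> \<Longrightarrow> {t a b |a b. a \<in> A \<and> b \<in> B} \<subseteq> carrier T"
  by auto

lemma tens_submodule:
  "\<lbrakk>A \<subseteq> carrier P1; B \<subseteq> carrier P2\<rbrakk> \<Longrightarrow> submodule class_ring (tens A B) T"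
  unfolding tens_def by (intro T.span_is_submodule generators_closed)

lemma tens_closed:
  "\<lbrakk>w \<in> tens A B; A \<subseteq> carrier P1; B \<subseteq> carrier P2\<rbrakk> \<Longrightarrow> w \<in> carrier T"
  using submodule.subset[OF tens_submodule] by blast

lemma t_in_tens: "\<lbrakk>a \<in> A; b \<in> B; A \<subseteq> carrier P1; B \<subseteq> carrier P2\<rbrakk> \<Longrightarrow> t a b \<in> tens A B"
  unfolding tens_def using T.in_own_span[OF generators_closed] by blast

lemma tens_mono: "\<lbrakk>A \<subseteq> A'; B \<subseteq> B'\<rbrakk> \<Longrightarrow> tens A B \<subseteq> tens A' B'"
  unfolding tens_def by (rule T.span_is_monotone) blast

lemma tens_least:
  "\<lbrakk>submodule class_ring N T; \<And>a b. a \<in> A \<Longrightarrow> b \<in> B \<Longrightarrow> t a b \<in> N\<rbrakk> \<Longrightarrow> tens A B \<subseteq> N"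
  unfolding tens_def by (rule T.span_is_subset) auto

lemma tens_induct [consumes 3, case_names t zero add smult]:
  assumes "w \<in> tens A B" "A \<subseteq> carrier P1" "B \<subseteq> carrier P2"
    and "\<And>a b. a \<in> A \<Longrightarrow> b \<in> B \<Longrightarrow> Q (t a b)"
    and "Q \<zero>\<^bsub>T\<^esub>"
    and "\<And>x y. x \<in> carrier T \<Longrightarrow> y \<in> carrier T \<Longrightarrow> Q x \<Longrightarrow> Q y \<Longrightarrow> Q (x \<oplus>\<^bsub>T\<^esub> y)"
    and "\<And>c x. x \<in> carrier T \<Longrightarrow> Q x \<Longrightarrow> Q (c \<odot>\<^bsub>T\<^esub> x)"
  shows "Q w"
  using assms generators_closed[OF assms(2,3)] unfolding tens_def
  by (elim T.span_induct) auto

lemma tens_carrier: "tens (carrier P1) (carrier P2) = carrier T"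
  using spanned tens_closed unfolding tens_def by auto

lemma tens_span_left:
  assumes S: "S \<subseteq> carrier P1" and a: "a \<in> V1.span S" and b: "b \<in> B" and B: "B \<subseteq> carrier P2"
  shows "t a b \<in> tens S B"
proof -
  note sub = tens_submodule[OF S B]
  have bc: "b \<in> carrier P2" using b B by auto
  show ?thesis using a S
    by (rule V1.span_induct)
      (use S b B bc submodule.zero_closed[OF sub] submodule.m_closed[OF sub] submodule.smult_closed[OF sub] in
        \<open>auto intro: t_in_tens simp: t_add_left t_smult_left\<close>)
qed

text \<open>Bilinearity collects all terms with left factor \<open>a\<close> into the single tensor
  \<open>t a y\<close>, so one left factor can be split off at a time.\<close>

lemma tens_insert:
  assumes S: "S \<subseteq> carrier P1" and a: "a \<in> carrier P1" and w: "w \<in> tens (insert a S) (carrier P2)"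
  shows "\<exists>u\<in>tens S (carrier P2). \<exists>y\<in>carrier P2. w = u \<oplus>\<^bsub>T\<^esub> t a y"
proof -
  note sub = tens_submodule[OF S subset_refl]
  have c: "u \<in> carrier T" if "u \<in> tens S (carrier P2)" for u using tens_closed[OF that S subset_refl] .
  have "insert a S \<subseteq> carrier P1" using a S by auto
  with w show ?thesis using subset_refl[of "carrier P2"]
  proof (induction rule: tens_induct)
    case (t x b)
    then consider "x = a" | "x \<in> S" by blast
    then show ?case
    proof cases
      case 1
      then show ?thesis using t a by (intro bexI[of _ "\<zero>\<^bsub>T\<^esub>"] bexI[of _ b]) (auto simp: submodule.zero_closed[OF sub])
    next
      case 2
      then have "t x b \<in> tens S (carrier P2)" using t S by (intro t_in_tens) auto
      then show ?thesis using c a by (intro bexI[of _ "t x b"] bexI[of _ "\<zero>\<^bsub>P2\<^esub>"]) auto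
    qed
  next
    case zero
    then show ?case using a by (intro bexI[of _ "\<zero>\<^bsub>T\<^esub>"] bexI[of _ "\<zero>\<^bsub>P2\<^esub>"]) (auto simp: submodule.zero_closed[OF sub])
  next
    case (add v w)
    then obtain u y u' y' where uy: "u \<in> tens S (carrier P2)" "y \<in> carrier P2" "v = u \<oplus>\<^bsub>T\<^esub> t a y"
      "u' \<in> tens S (carrier P2)" "y' \<in> carrier P2" "w = u' \<oplus>\<^bsub>T\<^esub> t a y'" by blast
    then have "v \<oplus>\<^bsub>T\<^esub> w = (u \<oplus>\<^bsub>T\<^esub> u') \<oplus>\<^bsub>T\<^esub> t a (y \<oplus>\<^bsub>P2\<^esub> y')"
      using a c by (simp add: t_add_right T.M.add.m_ac)
    then show ?case using uy submodule.m_closed[OF sub] by blast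
  next
    case (smult r v)
    then obtain u y where uy: "u \<in> tens S (carrier P2)" "y \<in> carrier P2" "v = u \<oplus>\<^bsub>T\<^esub> t a y" by blast
    then have "r \<odot>\<^bsub>T\<^esub> v = r \<odot>\<^bsub>T\<^esub> u \<oplus>\<^bsub>T\<^esub> t a (r \<odot>\<^bsub>P2\<^esub> y)"
      using a c by (simp add: t_smult_right T.smult_r_distr)
    then show ?case using uy submodule.smult_closed[OF sub, of r u] by (metis UNIV_I V2.smult_closed' partial_object.select_convs(1))
  qed
qed

text \<open>An element of a span involves only finitely many generators. This permits induction on
  the set of left factors and bounds the span of the contractions of a finite family of
  tensors.\<close>

lemma tens_finite_left:
  assumes w: "w \<in> tens A B" and A: "A \<subseteq> carrier P1" and B: "B \<subseteq> carrier P2"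
  shows "\<exists>S. finite S \<and> S \<subseteq> A \<and> w \<in> tens S B"
  using w A B
proof (induction rule: tens_induct)
  case (t a b)
  then show ?case using A B by (intro exI[of _ "{a}"]) (auto intro!: t_in_tens)
next
  case zero
  show ?case using B by (intro exI[of _ "{}"]) (auto intro!: submodule.zero_closed tens_submodule)
next
  case (add v w)
  then obtain S S' where S: "finite S" "S \<subseteq> A" "v \<in> tens S B" "finite S'" "S' \<subseteq> A" "w \<in> tens S' B" by blast
  then have "v \<in> tens (S \<union> S') B" "w \<in> tens (S \<union> S') B"
    using tens_mono[of S "S \<union> S'" B B] tens_mono[of S' "S \<union> S'" B B] by auto
  then show ?case using S A B
    by (intro exI[of _ "S \<union> S'"]) (auto intro!: submodule.m_closed tens_submodule)
next
  case (smult c v)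
  then obtain S where "finite S" "S \<subseteq> A" "v \<in> tens S B" by blast
  then show ?case using A B
    by (intro exI[of _ S]) (auto intro!: submodule.smult_closed tens_submodule)
qed

lemma contraction_mod_hom: "contraction P1 P2 T t g L \<Longrightarrow> mod_hom class_ring T P2 L"
  unfolding contraction_def by (intro mod_hom.intro mod_hom_axioms.intro T.module_axioms V2.module_axioms) auto

lemma contraction_t:
  "\<lbrakk>contraction P1 P2 T t g L; a \<in> carrier P1; b \<in> carrier P2\<rbrakk> \<Longrightarrow> L (t a b) = g a \<odot>\<^bsub>P2\<^esub> b"
  unfolding contraction_def by auto

lemma contraction_tens:
  assumes L: "contraction P1 P2 T t g L" and w: "w \<in> tens A B"
    and A: "A \<subseteq> carrier P1" and B: "submodule class_ring B P2"
  shows "L w \<in> B"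
proof -
  interpret L: mod_hom class_ring T P2 L by (rule contraction_mod_hom[OF L])
  have Bc: "B \<subseteq> carrier P2" by (rule submodule.subset[OF B])
  from w A Bc show ?thesis
  proof (induction rule: tens_induct)
    case (t a b)
    then have "L (t a b) = g a \<odot>\<^bsub>P2\<^esub> b" using A Bc by (intro contraction_t[OF L]) auto
    then show ?case using t submodule.smult_closed[OF B] by simp
  next
    case zero
    show ?case by (simp add: submodule.zero_closed[OF B])
  next
    case (add v w)
    then show ?case by (simp add: submodule.m_closed[OF B])
  next
    case (smult c v)
    then show ?case using L.f_smult[of c v] by (simp add: submodule.smult_closed[OF B])
  qed
qed

text \<open>A form that separates one of finitely many independent left factors from the others extracts the
  matching right factor.\<close>

lemma tens_by_contractions:
  assumes w: "w \<in> tens A (carrier P2)"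
    and A: "A \<subseteq> carrier P1" and B: "submodule class_ring B P2"
    and contr: "\<And>g L. linear_form P1 g \<Longrightarrow> contraction P1 P2 T t g L \<Longrightarrow> L w \<in> B"
  shows "w \<in> tens A B"
proof -
  have Bc: "B \<subseteq> carrier P2" by (rule submodule.subset[OF B])
  note sub = tens_submodule[OF A Bc]
  have "w \<in> tens A B" if "finite S" "S \<subseteq> A" "w \<in> tens S (carrier P2)"
      "\<And>g L. linear_form P1 g \<Longrightarrow> contraction P1 P2 T t g L \<Longrightarrow> L w \<in> B" for S w
    using that
  proof (induction S arbitrary: w rule: finite_induct)
    case empty
    then have "w \<in> T.span {}" by (simp add: tens_def)
    also have "T.span {} \<subseteq> tens A B" unfolding tens_def by (rule T.span_is_monotone) auto
    finally show ?case .
  next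
    case (insert a S)
    have S: "S \<subseteq> carrier P1" and aA: "a \<in> A" and a: "a \<in> carrier P1"
      using insert.prems(1) A by auto
    show ?case
    proof (cases "a \<in> V1.span S")
      case True
      have "t x b \<in> tens S (carrier P2)" if "x \<in> insert a S" "b \<in> carrier P2" for x b
        using that True S by (cases "x = a") (auto intro: tens_span_left t_in_tens)
      then have "tens (insert a S) (carrier P2) \<subseteq> tens S (carrier P2)"
        by (intro tens_least tens_submodule S) auto
      then show ?thesis using insert by blast
    next
      case False
      obtain g where g: "linear_form P1 g" "\<And>y. y \<in> V1.span S \<Longrightarrow> g y = 0" "g a = 1"
        using linear_form_separates[OF V1.span_is_submodule[OF S] a False] by blast
      obtain u y where uy: "u \<in> tens S (carrier P2)" "y \<in> carrier P2" "w = u \<oplus>\<^bsub>T\<^esub> t a y"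
        using tens_insert[OF S a insert.prems(2)] by blast
      have uc: "u \<in> carrier T" by (rule tens_closed[OF uy(1) S subset_refl])
      obtain L where L: "contraction P1 P2 T t g L" using contraction_left[OF g(1)] by blast
      interpret L: mod_hom class_ring T P2 L by (rule contraction_mod_hom[OF L])
      have gS: "g x = 0" if "x \<in> S" for x using that V1.in_own_span[OF S] g(2) by blast
      have "L u = \<zero>\<^bsub>P2\<^esub>" using uy(1) S subset_refl
      proof (induction rule: tens_induct)
        case (t x b)
        then have "L (t x b) = 0 \<odot>\<^bsub>P2\<^esub> b" using contraction_t[OF L, of x b] S gS by auto
        then show ?case using t by simp
      next
        case (smult c v)
        then show ?case using L.f_smult[of c v] by simp
      qed auto
      moreover have "L (t a y) = y" using contraction_t[OF L a uy(2)] g(3) uy(2) by simp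
      ultimately have "L w = y" using uy uc a by simp
      then have yB: "y \<in> B" using insert.prems(3)[OF g(1) L] by simp
      then have tB: "t a y \<in> tens A B" using aA A Bc by (intro t_in_tens)
      \<comment> \<open>Subtracting \<open>t a y\<close>, now known to lie in
        \<open>tens A B\<close>, changes every contraction by an element of \<open>B\<close>. The
        remainder \<open>u\<close> thus inherits the hypothesis on contractions.\<close>
      have "u \<in> tens A B"
      proof (rule insert.IH)
        show "S \<subseteq> A" using insert.prems(1) by auto
        show "u \<in> tens S (carrier P2)" by (rule uy(1))
        fix h M assume h: "linear_form P1 h" and M: "contraction P1 P2 T t h M"
        interpret M: mod_hom class_ring T P2 M by (rule contraction_mod_hom[OF M])
        have tc: "t a y \<in> carrier T" using a uy(2) by auto
        have wc: "w \<in> carrier T" using uc tc uy(3) by simp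
        have "u = w \<ominus>\<^bsub>T\<^esub> t a y"
          using uc tc uy(3) by (simp add: a_minus_def T.M.add.m_assoc T.M.r_neg)
        then have "M u = M w \<ominus>\<^bsub>P2\<^esub> M (t a y)" using wc tc by simp
        moreover have "M (t a y) \<in> B" by (rule contraction_tens[OF M tB A B])
        ultimately show "M u \<in> B"
          using insert.prems(3)[OF h M] submodule_minus_closed[OF B] by simp
      qed
      then show ?thesis using tB uy(3) submodule.m_closed[OF sub] by simp
    qed
  qed
  then show ?thesis using tens_finite_left[OF w A subset_refl] contr by blast
qed

text \<open>A form with value 1 at \<open>e\<close> contracts \<open>t e b\<close> to
  \<open>b\<close>, while contractions map \<open>tens A B\<close> into \<open>B\<close>. Every
  strict inclusion between tensor subspaces below comes from this.\<close>

lemma t_in_tens_rightD: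
  assumes e: "e \<in> carrier P1" "e \<noteq> \<zero>\<^bsub>P1\<^esub>" and b: "b \<in> carrier P2"
    and A: "A \<subseteq> carrier P1" and B: "submodule class_ring B P2" and tb: "t e b \<in> tens A B"
  shows "b \<in> B"
proof -
  have "submodule class_ring {\<zero>\<^bsub>P1\<^esub>} P1"
    by (intro submodule.intro V1.module_axioms) auto
  then obtain g where g: "linear_form P1 g" "g e = 1"
    using linear_form_separates[OF _ e(1), of "{\<zero>\<^bsub>P1\<^esub>}"] e(2) by blast
  obtain L where L: "contraction P1 P2 T t g L" using contraction_left[OF g(1)] by blast
  have "L (t e b) \<in> B" by (rule contraction_tens[OF L tb A B])
  then show ?thesis using contraction_t[OF L e(1) b] g(2) b by simp
qed

end

section \<open>The adjoint action on a tensor product\<close>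

lemma (in mod_hom) span_image:
  assumes x: "x \<in> M.span S" and S: "S \<subseteq> carrier M"
  shows "f x \<in> N.span (f ` S)"
proof -
  have fS: "f ` S \<subseteq> carrier N" using S by auto
  note sub = N.span_is_submodule[OF fS]
  show ?thesis using x S
    by (rule M.span_induct)
      (use N.in_own_span[OF fS] submodule.zero_closed[OF sub] submodule.m_closed[OF sub]
        submodule.smult_closed[OF sub] in auto)
qed

lemma (in ad_linear) Ev_ad_iff: "l \<in> Ev_ad P z \<longleftrightarrow> (\<exists>x\<in>eigenspace_ad P z l. x \<noteq> \<zero>)"
  by (auto simp: Ev_ad_def eigenspace_ad_def)

text \<open>The bracket enters only through \<open>ad_t\<close> and linearity, so both classes are
  treated at once.\<close>

locale tensor_ad =
  tensor_space P1 P2 T t + A1: ad_linear P1 z1 + A2: ad_linear P2 z2 + G: ad_linear T \<Gamma>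
  for P1 :: "('k::field, 'p) poisson" and P2 :: "('k, 'q) poisson" and T :: "('k, 't) poisson"
    and t :: "'p \<Rightarrow> 'q \<Rightarrow> 't" and z1 z2 \<Gamma> +
  assumes ad_t: "\<lbrakk>a \<in> carrier P1; b \<in> carrier P2\<rbrakk> \<Longrightarrow>
    ad T \<Gamma> (t a b) = t (ad P1 z1 a) b \<oplus>\<^bsub>T\<^esub> t a (ad P2 z2 b)"
begin

text \<open>All terms are linear in \<open>w\<close>, and on \<open>t a b\<close> both sides are
  f(b) ad(a) + f(ad(b)) a.\<close>

lemma contraction_right_ad:
  assumes L: "contraction P2 P1 T (\<lambda>b a. t a b) f L"
    and L': "contraction P2 P1 T (\<lambda>b a. t a b) (\<lambda>b. f (ad P2 z2 b)) L'"
    and w: "w \<in> carrier T"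
  shows "L (ad T \<Gamma> w) = ad P1 z1 (L w) \<oplus>\<^bsub>P1\<^esub> L' w"
proof -
  interpret swap: tensor_space P2 P1 T "\<lambda>b a. t a b" by (rule tensor_space_swap)
  interpret L: mod_hom class_ring T P1 L by (rule swap.contraction_mod_hom[OF L])
  interpret L': mod_hom class_ring T P1 L' by (rule swap.contraction_mod_hom[OF L'])
  from w have "w \<in> tens (carrier P1) (carrier P2)" by (simp add: tens_carrier)
  from this subset_refl subset_refl show ?thesis
  proof (induction rule: tens_induct)
    case (t a b)
    then show ?case
      using swap.contraction_t[OF L] swap.contraction_t[OF L'] by (simp add: ad_t A1.ad_smult)
  next
    case (add v w)
    then show ?case by (simp add: G.ad_add A1.ad_add V1.M.add.m_ac)
  next
    case (smult c v)
    then show ?case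
      using L.f_smult[of c] L'.f_smult[of c]
      by (simp add: G.ad_smult A1.ad_smult V1.smult_r_distr)
  qed simp
qed

lemma contraction_right_F_ad:
  assumes w: "w \<in> F_ad T \<Gamma>" and f: "linear_form P2 f"
    and L: "contraction P2 P1 T (\<lambda>b a. t a b) f L"
  shows "L w \<in> F_ad P1 z1"
proof -
  interpret swap: tensor_space P2 P1 T "\<lambda>b a. t a b" by (rule tensor_space_swap)
  have wc: "w \<in> carrier T" using w by (simp add: F_ad_def)
  \<comment> \<open>The exponent and the form must both vary: applying \<open>ad P1 z1\<close> to a
    contraction leads to the next iterate on the one hand and to the form composed with
    \<open>ad P2 z2\<close> on the other.\<close>
  define U0 where "U0 = {M ((ad T \<Gamma> ^^ n) w) |n f M. linear_form P2 f \<and> contraction P2 P1 T (\<lambda>b a. t a b) f M}"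
  have U0I: "M ((ad T \<Gamma> ^^ n) w) \<in> U0"
    if "linear_form P2 f" "contraction P2 P1 T (\<lambda>b a. t a b) f M" for n f M
    unfolding U0_def by (intro CollectI exI conjI) (rule refl that)+
  define U where "U = V1.span U0"
  have U0c: "U0 \<subseteq> carrier P1"
    unfolding U0_def using wc mod_hom.f_im[OF swap.contraction_mod_hom] by auto
  have Usub: "submodule class_ring U P1" unfolding U_def by (rule V1.span_is_submodule[OF U0c])
  have U0U: "U0 \<subseteq> U" unfolding U_def by (rule V1.in_own_span[OF U0c])
  have ad_U0: "ad P1 z1 x \<in> U" if "x \<in> U0" for x
  proof -
    obtain n f M where x: "x = M ((ad T \<Gamma> ^^ n) w)" and f: "linear_form P2 f"
      and M: "contraction P2 P1 T (\<lambda>b a. t a b) f M"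
      using \<open>x \<in> U0\<close> unfolding U0_def by blast
    have f': "linear_form P2 (\<lambda>b. f (ad P2 z2 b))"
      using f by (auto simp: linear_form_def A2.ad_add A2.ad_smult)
    obtain M' where M': "contraction P2 P1 T (\<lambda>b a. t a b) (\<lambda>b. f (ad P2 z2 b)) M'"
      using contraction_right[OF f'] by blast
    interpret M: mod_hom class_ring T P1 M by (rule swap.contraction_mod_hom[OF M])
    interpret M': mod_hom class_ring T P1 M' by (rule swap.contraction_mod_hom[OF M'])
    let ?v = "(ad T \<Gamma> ^^ n) w"
    have v: "?v \<in> carrier T" using wc by simp
    have in_U: "M ((ad T \<Gamma> ^^ Suc n) w) \<in> U" "M' ?v \<in> U"
      using U0U U0I[OF f M] U0I[OF f' M'] by blast+
    have "M (ad T \<Gamma> ?v) = ad P1 z1 (M ?v) \<oplus>\<^bsub>P1\<^esub> M' ?v"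
      by (rule contraction_right_ad[OF M M' v])
    then have "ad P1 z1 (M ?v) = M (ad T \<Gamma> ?v) \<ominus>\<^bsub>P1\<^esub> M' ?v"
      using v by (simp add: a_minus_def V1.M.add.m_assoc V1.M.r_neg)
    then show ?thesis using submodule_minus_closed[OF Usub in_U] by (simp add: x)
  qed
  have ad_U: "ad P1 z1 x \<in> U" if "x \<in> U" for x
    using that[unfolded U_def] U0c
    by (rule V1.span_induct)
      (use ad_U0 submodule.zero_closed[OF Usub] submodule.m_closed[OF Usub]
        submodule.smult_closed[OF Usub] in \<open>auto simp: A1.ad_add A1.ad_smult\<close>)
  have LwU: "L w \<in> U"
    using U0U U0I[OF f L, of 0] by auto
  have orbit: "(ad P1 z1 ^^ n) (L w) \<in> U" for n
    by (induction n) (auto simp: LwU ad_U)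
  obtain B where B: "finite B" "B \<subseteq> carrier T" "\<And>n. (ad T \<Gamma> ^^ n) w \<in> T.span B"
    using w wc G.F_ad_iff by blast
  have "\<forall>x\<in>B. \<exists>S. finite S \<and> S \<subseteq> carrier P1 \<and> x \<in> tens S (carrier P2)"
    using B(2) tens_carrier by (auto intro!: tens_finite_left)
  then obtain S where S: "\<And>x. x \<in> B \<Longrightarrow> finite (S x) \<and> S x \<subseteq> carrier P1 \<and> x \<in> tens (S x) (carrier P2)"
    by metis
  \<comment> \<open>\<open>X\<close> collects the finitely many left factors that occur in a
    spanning set of the orbit of \<open>w\<close>. Every contraction of every iterate then lies in
    the span of \<open>X\<close>, whatever the form.\<close>
  define X where "X = (\<Union>x\<in>B. S x)"
  have X: "finite X" "X \<subseteq> carrier P1" using B(1) S unfolding X_def by auto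
  have spX: "submodule class_ring (V1.span X) P1" by (rule V1.span_is_submodule[OF X(2)])
  have "B \<subseteq> tens (V1.span X) (carrier P2)"
  proof
    fix x assume x: "x \<in> B"
    then have "S x \<subseteq> V1.span X" using V1.in_own_span[OF X(2)] unfolding X_def by blast
    then show "x \<in> tens (V1.span X) (carrier P2)"
      using S[OF x] tens_mono[of "S x" "V1.span X" "carrier P2" "carrier P2"] by blast
  qed
  then have "T.span B \<subseteq> tens (V1.span X) (carrier P2)"
    by (intro T.span_is_subset tens_submodule submodule.subset[OF spX] subset_refl)
  \<comment> \<open>Contractions into P1 are those of the swapped tensor space, so the factors are
    exchanged before \<open>contraction_tens\<close> is applied.\<close>
  also have "\<dots> = swap.tens (carrier P2) (V1.span X)"
    unfolding tens_def swap.tens_def by (rule arg_cong[of _ _ T.span]) blast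
  finally have "(ad T \<Gamma> ^^ n) w \<in> swap.tens (carrier P2) (V1.span X)" for n
    using B(3) by blast
  then have "U0 \<subseteq> V1.span X"
    unfolding U0_def using swap.contraction_tens[OF _ _ subset_refl spX] by blast
  then have "U \<subseteq> V1.span X" unfolding U_def by (intro V1.span_is_subset spX)
  then have "\<forall>n. (ad P1 z1 ^^ n) (L w) \<in> V1.span X" using orbit by blast
  then show ?thesis
    using X submodule.subset[OF Usub] LwU by (subst A1.F_ad_iff) auto
qed

lemma tens_swap: "tensor_space.tens T (\<lambda>b a. t a b) B A = tens A B"
proof -
  interpret swap: tensor_space P2 P1 T "\<lambda>b a. t a b" by (rule tensor_space_swap)
  show ?thesis unfolding tens_def swap.tens_def by (rule arg_cong[of _ _ T.span]) blast
qed

text \<open>The contraction test in the swapped space, with \<open>contraction_right_F_ad\<close>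
  supplying the contractions. This inclusion holds before F(z1) = C(z1) is assumed.\<close>

lemma F_ad_subset_tens: "F_ad T \<Gamma> \<subseteq> tens (F_ad P1 z1) (carrier P2)"
proof
  interpret swap: tensor_space P2 P1 T "\<lambda>b a. t a b" by (rule tensor_space_swap)
  fix w assume w: "w \<in> F_ad T \<Gamma>"
  then have "w \<in> swap.tens (carrier P2) (carrier P1)"
    unfolding tens_swap tens_carrier by (simp add: F_ad_def)
  then have "w \<in> swap.tens (carrier P2) (F_ad P1 z1)"
    by (rule swap.tens_by_contractions[OF _ subset_refl A1.F_ad_submodule])
      (rule contraction_right_F_ad[OF w])
  then show "w \<in> tens (F_ad P1 z1) (carrier P2)" unfolding tens_swap .
qed

lemma t_left_hom: "a \<in> carrier P1 \<Longrightarrow> mod_hom class_ring P2 T (t a)"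
  by (intro mod_hom.intro mod_hom_axioms.intro T.module_axioms V2.module_axioms)
    (auto simp: LinearCombinations.module_hom_def t_add_right t_smult_right)

section \<open>The action of \<open>ad T \<Gamma>\<close> on C(z1) \<otimes> P2\<close>

lemma C_ad_closed: "C_ad P1 z1 \<subseteq> carrier P1"
  by (auto simp: C_ad_def)

lemma ad_t_C: "\<lbrakk>a \<in> C_ad P1 z1; b \<in> carrier P2\<rbrakk> \<Longrightarrow> ad T \<Gamma> (t a b) = t a (ad P2 z2 b)"
  by (simp add: C_ad_def ad_t)

lemma ad_pow_t_C:
  "\<lbrakk>a \<in> C_ad P1 z1; b \<in> carrier P2\<rbrakk> \<Longrightarrow> (ad T \<Gamma> ^^ n) (t a b) = t a ((ad P2 z2 ^^ n) b)"
  by (induction n) (auto simp: ad_t_C)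

text \<open>For a left factor in C(z1) the first summand of \<open>ad_t\<close> vanishes. Stability
  is proved together with the commutation rule because the rule concerns tensors of this subspace
  and has to be iterated.\<close>

lemma ad_tens_C:
  assumes w: "w \<in> tens (C_ad P1 z1) (carrier P2)"
  shows "ad T \<Gamma> w \<in> tens (C_ad P1 z1) (carrier P2)"
    and "contraction P1 P2 T t g L \<Longrightarrow> L (ad T \<Gamma> w) = ad P2 z2 (L w)"
proof -
  note sub = tens_submodule[OF C_ad_closed subset_refl]
  from w C_ad_closed subset_refl show "ad T \<Gamma> w \<in> tens (C_ad P1 z1) (carrier P2)"
  proof (induction rule: tens_induct)
    case (t a b)
    then show ?case using C_ad_closed by (auto simp: ad_t_C intro!: t_in_tens)
  qed (auto simp: G.ad_add G.ad_smult submodule.zero_closed[OF sub] submodule.m_closed[OF sub]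
      submodule.smult_closed[OF sub])
  assume L: "contraction P1 P2 T t g L"
  interpret L: mod_hom class_ring T P2 L by (rule contraction_mod_hom[OF L])
  from w C_ad_closed subset_refl show "L (ad T \<Gamma> w) = ad P2 z2 (L w)"
  proof (induction rule: tens_induct)
    case (t a b)
    then have "a \<in> carrier P1" using C_ad_closed by auto
    then show ?case using t by (simp add: ad_t_C contraction_t[OF L] A2.ad_smult)
  next
    case (smult c v)
    then show ?case using L.f_smult[of c] by (simp add: G.ad_smult A2.ad_smult)
  qed (auto simp: G.ad_add A2.ad_add)
qed

lemma ad_pow_tens_C:
  assumes w: "w \<in> tens (C_ad P1 z1) (carrier P2)" and L: "contraction P1 P2 T t g L"
  shows "L ((ad T \<Gamma> ^^ n) w) = (ad P2 z2 ^^ n) (L w)"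
proof -
  have "(ad T \<Gamma> ^^ n) w \<in> tens (C_ad P1 z1) (carrier P2)" for n
    by (induction n) (auto simp: w ad_tens_C(1))
  then show ?thesis using ad_tens_C(2)[OF _ L] by (induction n) auto
qed

section \<open>The four equalities under F(z1) = C(z1)\<close>

context
  assumes F_C: "F_ad P1 z1 = C_ad P1 z1"
begin

lemma in_tens_C: "w \<in> F_ad T \<Gamma> \<Longrightarrow> w \<in> tens (C_ad P1 z1) (carrier P2)"
  using F_ad_subset_tens F_C by auto

text \<open>Finite witnesses move in both directions along linear maps that intertwine the two
  adjoint actions: a contraction carries a witness for \<open>w\<close> to P2, and
  \<open>t a\<close> with a in C(z1) carries a witness for \<open>b\<close> back.\<close>

lemma F_ad_eq_tens: "F_ad T \<Gamma> = tens (C_ad P1 z1) (F_ad P2 z2)"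
proof
  show "F_ad T \<Gamma> \<subseteq> tens (C_ad P1 z1) (F_ad P2 z2)"
  proof
    fix w assume w: "w \<in> F_ad T \<Gamma>"
    then have wc: "w \<in> carrier T" by (simp add: F_ad_def)
    obtain B where B: "finite B" "B \<subseteq> carrier T" "\<And>n. (ad T \<Gamma> ^^ n) w \<in> T.span B"
      using w wc G.F_ad_iff by blast
    show "w \<in> tens (C_ad P1 z1) (F_ad P2 z2)"
    proof (rule tens_by_contractions[OF in_tens_C[OF w] C_ad_closed A2.F_ad_submodule])
      fix g L assume L: "contraction P1 P2 T t g L"
      interpret L: mod_hom class_ring T P2 L by (rule contraction_mod_hom[OF L])
      have "(ad P2 z2 ^^ n) (L w) \<in> V2.span (L ` B)" for n
        using L.span_image[OF B(3) B(2)] ad_pow_tens_C[OF in_tens_C[OF w] L, of n] by metis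
      then show "L w \<in> F_ad P2 z2"
        using B wc by (subst A2.F_ad_iff) (auto intro!: exI[of _ "L ` B"])
    qed
  qed
  show "tens (C_ad P1 z1) (F_ad P2 z2) \<subseteq> F_ad T \<Gamma>"
  proof (rule tens_least[OF G.F_ad_submodule])
    fix a b assume a: "a \<in> C_ad P1 z1" and b: "b \<in> F_ad P2 z2"
    have c: "a \<in> carrier P1" "b \<in> carrier P2" using a b by (auto simp: C_ad_def F_ad_def)
    obtain B where B: "finite B" "B \<subseteq> carrier P2" "\<And>n. (ad P2 z2 ^^ n) b \<in> V2.span B"
      using b c A2.F_ad_iff by blast
    have "(ad T \<Gamma> ^^ n) (t a b) \<in> T.span (t a ` B)" for n
      using mod_hom.span_image[OF t_left_hom[OF c(1)] B(3) B(2)] ad_pow_t_C[OF a c(2)] by metis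
    then show "t a b \<in> F_ad T \<Gamma>"
      using B c by (subst G.F_ad_iff) (auto intro!: exI[of _ "t a ` B"])
  qed
qed

text \<open>N(\<Gamma>) is contained in F(\<Gamma>), hence in C(z1) \<otimes> P2. There the same
  exponent serves \<open>w\<close> and its contractions, and likewise \<open>b\<close> and
  \<open>t a b\<close>.\<close>

lemma N_ad_eq_tens: "N_ad T \<Gamma> = tens (C_ad P1 z1) (N_ad P2 z2)"
proof
  show "N_ad T \<Gamma> \<subseteq> tens (C_ad P1 z1) (N_ad P2 z2)"
  proof
    fix w assume w: "w \<in> N_ad T \<Gamma>"
    then obtain m where m: "(ad T \<Gamma> ^^ m) w = \<zero>\<^bsub>T\<^esub>" and wc: "w \<in> carrier T" by (auto simp: N_ad_def)
    have wC: "w \<in> tens (C_ad P1 z1) (carrier P2)" using w G.N_ad_subset_F_ad in_tens_C by blast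
    show "w \<in> tens (C_ad P1 z1) (N_ad P2 z2)"
    proof (rule tens_by_contractions[OF wC C_ad_closed A2.N_ad_submodule])
      fix g L assume L: "contraction P1 P2 T t g L"
      interpret L: mod_hom class_ring T P2 L by (rule contraction_mod_hom[OF L])
      have "(ad P2 z2 ^^ m) (L w) = \<zero>\<^bsub>P2\<^esub>"
        using ad_pow_tens_C[OF wC L, of m] m by simp
      then show "L w \<in> N_ad P2 z2" using wc by (auto simp: N_ad_def)
    qed
  qed
  show "tens (C_ad P1 z1) (N_ad P2 z2) \<subseteq> N_ad T \<Gamma>"
  proof (rule tens_least[OF G.N_ad_submodule])
    fix a b assume a: "a \<in> C_ad P1 z1" and b: "b \<in> N_ad P2 z2"
    have c: "a \<in> carrier P1" "b \<in> carrier P2" using a b by (auto simp: C_ad_def N_ad_def)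
    obtain m where m: "(ad P2 z2 ^^ m) b = \<zero>\<^bsub>P2\<^esub>" using b by (auto simp: N_ad_def)
    then have "(ad T \<Gamma> ^^ m) (t a b) = \<zero>\<^bsub>T\<^esub>" using ad_pow_t_C[OF a c(2), of m] c by simp
    then show "t a b \<in> N_ad T \<Gamma>" using c by (auto simp: N_ad_def)
  qed
qed

lemma t_eigenspace:
  "\<lbrakk>a \<in> C_ad P1 z1; b \<in> eigenspace_ad P2 z2 l\<rbrakk> \<Longrightarrow> t a b \<in> eigenspace_ad T \<Gamma> l"
  using C_ad_closed by (auto simp: eigenspace_ad_def ad_t_C t_smult_right)

text \<open>Eigenvectors lie in F(\<Gamma>), hence in C(z1) \<otimes> P2, where contractions
  intertwine the two actions and so preserve eigenvalues. With \<open>l = 0\<close> this is the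
  claim about C; the claims about D and about the eigenvalues also rest on it.\<close>

lemma eigenspace_ad_eq_tens:
  "eigenspace_ad T \<Gamma> l = tens (C_ad P1 z1) (eigenspace_ad P2 z2 l)"
proof
  show "eigenspace_ad T \<Gamma> l \<subseteq> tens (C_ad P1 z1) (eigenspace_ad P2 z2 l)"
  proof
    fix w assume w: "w \<in> eigenspace_ad T \<Gamma> l"
    then have wc: "w \<in> carrier T" and eq: "ad T \<Gamma> w = l \<odot>\<^bsub>T\<^esub> w" by (auto simp: eigenspace_ad_def)
    have wC: "w \<in> tens (C_ad P1 z1) (carrier P2)"
      using w G.eigenspace_ad_subset_F_ad in_tens_C by blast
    show "w \<in> tens (C_ad P1 z1) (eigenspace_ad P2 z2 l)"
    proof (rule tens_by_contractions[OF wC C_ad_closed A2.eigenspace_ad_submodule])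
      fix g L assume L: "contraction P1 P2 T t g L"
      interpret L: mod_hom class_ring T P2 L by (rule contraction_mod_hom[OF L])
      have "ad P2 z2 (L w) = l \<odot>\<^bsub>P2\<^esub> L w"
        using ad_tens_C(2)[OF wC L] eq L.f_smult[of l w] wc by simp
      then show "L w \<in> eigenspace_ad P2 z2 l" using wc by (auto simp: eigenspace_ad_def)
    qed
  qed
  show "tens (C_ad P1 z1) (eigenspace_ad P2 z2 l) \<subseteq> eigenspace_ad T \<Gamma> l"
    by (intro tens_least G.eigenspace_ad_submodule t_eigenspace)
qed

lemma C_ad_eq_tens: "C_ad T \<Gamma> = tens (C_ad P1 z1) (C_ad P2 z2)"
  using eigenspace_ad_eq_tens[of 0] by (simp add: G.C_ad_eq_eigenspace A2.C_ad_eq_eigenspace)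

lemma D_ad_eq_tens: "D_ad T \<Gamma> = tens (C_ad P1 z1) (D_ad P2 z2)"
proof
  note D2c = submodule.subset[OF A2.D_ad_submodule]
  show "D_ad T \<Gamma> \<subseteq> tens (C_ad P1 z1) (D_ad P2 z2)"
    by (intro G.D_ad_subset tens_submodule C_ad_closed D2c)
      (auto simp: eigenspace_ad_eq_tens intro: subsetD[OF tens_mono[OF subset_refl A2.eigenspace_ad_subset_D_ad]])
  show "tens (C_ad P1 z1) (D_ad P2 z2) \<subseteq> D_ad T \<Gamma>"
  proof (rule tens_least[OF G.D_ad_submodule])
    fix a b assume a: "a \<in> C_ad P1 z1" and b: "b \<in> D_ad P2 z2"
    have c: "a \<in> carrier P1" using a by (auto simp: C_ad_def)
    note sub = G.D_ad_submodule
    \<comment> \<open>For fixed \<open>a\<close> the admissible right factors form a subspace, so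
      checking eigenvectors is enough.\<close>
    have "D_ad P2 z2 \<subseteq> {b \<in> carrier P2. t a b \<in> D_ad T \<Gamma>}"
    proof (rule A2.D_ad_subset)
      show "submodule class_ring {b \<in> carrier P2. t a b \<in> D_ad T \<Gamma>} P2"
        using c by (intro submodule.intro V2.module_axioms)
          (auto simp: t_add_right t_smult_right submodule.zero_closed[OF sub]
            submodule.m_closed[OF sub] submodule.smult_closed[OF sub])
      show "eigenspace_ad P2 z2 l \<subseteq> {b \<in> carrier P2. t a b \<in> D_ad T \<Gamma>}" for l
        using t_eigenspace[OF a] G.eigenspace_ad_subset_D_ad by (auto simp: eigenspace_ad_def)
    qed
    then show "t a b \<in> D_ad T \<Gamma>" using b by auto
  qed
qed

section \<open>The type of \<Gamma>\<close>

context
  assumes C_proper: "C_ad P1 z1 \<subset> carrier P1" and C_nonzero: "C_ad P1 z1 \<noteq> {\<zero>\<^bsub>P1\<^esub>}"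
    and \<Gamma>_closed: "\<Gamma> \<in> carrier T"
begin

text \<open>Take \<open>e\<close> nonzero in C(z1) and \<open>b\<close> in \<open>Y\<close> outside
  \<open>X\<close>: by contraction, \<open>t e b\<close> cannot lie in
  \<open>tens (C_ad P1 z1) X\<close>.\<close>

lemma tens_C_mono_strict:
  assumes X: "submodule class_ring X P2" and Y: "Y \<subseteq> carrier P2" and XY: "X \<subset> Y"
  shows "tens (C_ad P1 z1) X \<subset> tens (C_ad P1 z1) Y"
proof -
  obtain e where e: "e \<in> C_ad P1 z1" "e \<noteq> \<zero>\<^bsub>P1\<^esub>"
    using C_nonzero submodule.zero_closed[OF A1.C_ad_submodule] by blast
  obtain b where b: "b \<in> Y" "b \<notin> X" using XY by blast
  have "t e b \<in> tens (C_ad P1 z1) Y" using e b Y C_ad_closed by (intro t_in_tens)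
  moreover have "t e b \<notin> tens (C_ad P1 z1) X"
    using t_in_tens_rightD[OF _ e(2) _ C_ad_closed X] e b Y C_ad_closed by blast
  ultimately show ?thesis using tens_mono[of "C_ad P1 z1" "C_ad P1 z1" X Y] XY by blast
qed

text \<open>Tensoring an eigenspace with the nonzero space C(z1) gives zero exactly when the
  eigenspace is zero.\<close>

lemma Ev_ad_eq: "Ev_ad T \<Gamma> = Ev_ad P2 z2"
proof -
  have "l \<in> Ev_ad T \<Gamma> \<longleftrightarrow> l \<in> Ev_ad P2 z2" for l
  proof
    have zero: "submodule class_ring {\<zero>\<^bsub>P2\<^esub>} P2"
      by (intro submodule.intro V2.module_axioms) auto
    assume "l \<in> Ev_ad P2 z2"
    then have "{\<zero>\<^bsub>P2\<^esub>} \<subset> eigenspace_ad P2 z2 l"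
      unfolding A2.Ev_ad_iff using submodule.zero_closed[OF A2.eigenspace_ad_submodule] by blast
    then have "tens (C_ad P1 z1) {\<zero>\<^bsub>P2\<^esub>} \<subset> eigenspace_ad T \<Gamma> l"
      unfolding eigenspace_ad_eq_tens
      by (intro tens_C_mono_strict zero submodule.subset[OF A2.eigenspace_ad_submodule])
    \<comment> \<open>The strict inclusion provides an eigenvector outside
      \<open>tens (C_ad P1 z1) {\<zero>}\<close>; as zero belongs to that space, the eigenvector is
      nonzero.\<close>
    moreover have "\<zero>\<^bsub>T\<^esub> \<in> tens (C_ad P1 z1) {\<zero>\<^bsub>P2\<^esub>}"
      by (intro submodule.zero_closed[OF tens_submodule] C_ad_closed submodule.subset[OF zero])
    ultimately show "l \<in> Ev_ad T \<Gamma>" unfolding G.Ev_ad_iff by (metis psubset_imp_ex_mem DiffE)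
  next
    have zero: "submodule class_ring {\<zero>\<^bsub>T\<^esub>} T"
      by (intro submodule.intro T.module_axioms) auto
    assume l: "l \<in> Ev_ad T \<Gamma>"
    show "l \<in> Ev_ad P2 z2"
    proof (rule ccontr)
      assume "l \<notin> Ev_ad P2 z2"
      then have "eigenspace_ad P2 z2 l \<subseteq> {\<zero>\<^bsub>P2\<^esub>}" unfolding A2.Ev_ad_iff by blast
      then have "tens (C_ad P1 z1) (eigenspace_ad P2 z2 l) \<subseteq> {\<zero>\<^bsub>T\<^esub>}"
        using C_ad_closed t_zero_right by (intro tens_least zero) blast
      then show False using l unfolding G.Ev_ad_iff eigenspace_ad_eq_tens by blast
    qed
  qed
  then show ?thesis by blast
qed

text \<open>An eigenvalue of z2 guarantees a nonzero \<open>b\<close> in P2. For \<open>a\<close>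
  outside C(z1), \<open>t a b\<close> is not in C(z1) \<otimes> P2 and therefore not in
  F(\<Gamma>).\<close>

lemma F_ad_proper:
  assumes "Ev_ad P2 z2 \<noteq> {}"
  shows "F_ad T \<Gamma> \<subset> carrier T"
proof -
  interpret swap: tensor_space P2 P1 T "\<lambda>b a. t a b" by (rule tensor_space_swap)
  obtain b where b: "b \<in> carrier P2" "b \<noteq> \<zero>\<^bsub>P2\<^esub>" using assms by (auto simp: Ev_ad_def)
  obtain a where a: "a \<in> carrier P1" "a \<notin> C_ad P1 z1" using C_proper by blast
  have "t a b \<notin> swap.tens (carrier P2) (C_ad P1 z1)"
    using swap.t_in_tens_rightD[OF b a(1) subset_refl A1.C_ad_submodule] a(2) by blast
  then have "t a b \<notin> F_ad T \<Gamma>" unfolding tens_swap using in_tens_C by blast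
  moreover have "t a b \<in> carrier T" using a b by simp
  ultimately show ?thesis unfolding F_ad_def by blast
qed

lemma Omega0'_if:
  assumes "z2 \<in> Omega0 P2 \<union> Omega0' P2"
  shows "\<Gamma> \<in> Omega0' T"
proof -
  \<comment> \<open>\<open>Omega0\<close> does not state C(z2) = F(z2); there it follows from C(z2)
    = P2 and the chain C \<subseteq> N \<subseteq> F \<subseteq> P2.\<close>
  have "F_ad P2 z2 \<subseteq> carrier P2" by (auto simp: F_ad_def)
  then have "Ev_ad P2 z2 = {0}" "C_ad P2 z2 = F_ad P2 z2"
    using assms A2.C_ad_subset_N_ad A2.N_ad_subset_F_ad by (auto simp: Omega0_def Omega0'_def)
  then show ?thesis
    unfolding Omega0'_def using F_ad_proper \<Gamma>_closed by (auto simp: Ev_ad_eq C_ad_eq_tens F_ad_eq_tens)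
qed

lemma Omega1'_if:
  assumes "z2 \<in> Omega1 P2 \<union> Omega1' P2"
  shows "\<Gamma> \<in> Omega1' T"
proof -
  have Ev: "Ev_ad P2 z2 = {0}" and "C_ad P2 z2 \<subset> N_ad P2 z2"
    using assms by (auto simp: Omega1_def Omega1'_def)
  then have "C_ad T \<Gamma> \<subset> N_ad T \<Gamma>"
    unfolding C_ad_eq_tens N_ad_eq_tens
    by (intro tens_C_mono_strict A2.C_ad_submodule submodule.subset[OF A2.N_ad_submodule])
  \<comment> \<open>Properness comes from F(\<Gamma>) and does not depend on whether N(z2) is all of
    P2.\<close>
  moreover have "N_ad T \<Gamma> \<subset> carrier T" using F_ad_proper G.N_ad_subset_F_ad Ev by auto
  ultimately show ?thesis unfolding Omega1'_def using \<Gamma>_closed Ev by (simp add: Ev_ad_eq)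
qed

lemma Omega2'_if:
  assumes "z2 \<in> Omega2 P2 \<union> Omega2' P2"
  shows "\<Gamma> \<in> Omega2' T"
proof -
  have Ev: "{0} \<subset> Ev_ad P2 z2" and "D_ad P2 z2 = F_ad P2 z2"
    using assms by (auto simp: Omega2_def Omega2'_def)
  then have "D_ad T \<Gamma> = F_ad T \<Gamma>" by (simp add: D_ad_eq_tens F_ad_eq_tens)
  moreover have "F_ad T \<Gamma> \<subset> carrier T" using Ev by (intro F_ad_proper) auto
  ultimately show ?thesis unfolding Omega2'_def using \<Gamma>_closed Ev by (simp add: Ev_ad_eq)
qed

lemma Omega3'_if:
  assumes "z2 \<in> Omega3 P2 \<union> Omega3' P2"
  shows "\<Gamma> \<in> Omega3' T"
proof -
  have Ev: "{0} \<subset> Ev_ad P2 z2" and "D_ad P2 z2 \<subset> F_ad P2 z2"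
    using assms by (auto simp: Omega3_def Omega3'_def)
  then have "D_ad T \<Gamma> \<subset> F_ad T \<Gamma>"
    unfolding D_ad_eq_tens F_ad_eq_tens
    by (intro tens_C_mono_strict A2.D_ad_submodule submodule.subset[OF A2.F_ad_submodule])
  moreover have "F_ad T \<Gamma> \<subset> carrier T" using Ev by (intro F_ad_proper) auto
  ultimately show ?thesis unfolding Omega3'_def using \<Gamma>_closed Ev by (simp add: Ev_ad_eq)
qed

end
end
end

section \<open>The concrete tensor product\<close>

definition free_ext :: "('i \<Rightarrow> ('j \<Rightarrow>\<^sub>0 'k::field)) \<Rightarrow> ('i \<Rightarrow>\<^sub>0 'k) \<Rightarrow> ('j \<Rightarrow>\<^sub>0 'k)" where
  "free_ext b f = (\<Sum>p\<in>Poly_Mapping.keys f. free_smult (Poly_Mapping.lookup f p) (b p))"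

lemma free_ext_superset:
  assumes "finite A" "Poly_Mapping.keys f \<subseteq> A"
  shows "free_ext b f = (\<Sum>p\<in>A. free_smult (Poly_Mapping.lookup f p) (b p))"
  unfolding free_ext_def using assms by (intro sum.mono_neutral_left) (auto simp: in_keys_iff)

lemma free_ext_single [simp]: "free_ext b (Poly_Mapping.single p c) = free_smult c (b p)"
  using free_ext_superset[of "{p}" "Poly_Mapping.single p c" b] by simp

lemma free_ext_add: "free_ext b (f + g) = free_ext b f + free_ext b g"
proof -
  let ?A = "Poly_Mapping.keys f \<union> Poly_Mapping.keys g"
  show ?thesis
    using free_ext_superset[of ?A "f + g" b] free_ext_superset[of ?A f b] free_ext_superset[of ?A g b]
      keys_add[of f g]
    by (simp add: lookup_add free.scale_left_distrib sum.distrib)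
qed

lemma free_ext_smult: "free_ext b (free_smult c f) = free_smult c (free_ext b f)"
  using free_ext_superset[of "Poly_Mapping.keys f" "free_smult c f" b] keys_free_smult[of c f]
  by (simp add: free_ext_def free.scale_sum_right)

lemma free_ext_zero [simp]: "free_ext b 0 = 0"
  by (simp add: free_ext_def)

lemma free_ext_diff: "free_ext b (f - g) = free_ext b f - free_ext b g"
  using free_ext_add[of b "f - g" g] by simp

text \<open>A bilinear extension is two nested linear ones. This nesting exposes the first argument
  and the swapped one the second, so linearity in either slot reduces to that of
  \<open>free_ext\<close>.\<close>

lemma bilinear_ext_eq: "bilinear_ext b f g = free_ext (\<lambda>p. free_ext (b p) g) f"
  by (simp add: bilinear_ext_def free_ext_def free.scale_sum_right)

lemma bilinear_ext_eq_swap: "bilinear_ext b f g = free_ext (\<lambda>q. free_ext (\<lambda>p. b p q) f) g"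
  unfolding bilinear_ext_def free_ext_def free.scale_sum_right
  by (subst sum.swap) (simp add: mult.commute)

text \<open>Turns the commutator on the free space into a single bilinear extension, so that it can
  be handled like the Class 1 bracket.\<close>

lemma bilinear_ext_diff:
  "bilinear_ext b f g - bilinear_ext b' g f = bilinear_ext (\<lambda>p q. b p q - b' q p) f g"
proof -
  have "bilinear_ext b' g f = free_ext (\<lambda>p. free_ext (\<lambda>q. b' q p) g) f"
    by (rule bilinear_ext_eq_swap)
  then show ?thesis
    unfolding bilinear_ext_eq free_ext_def
    by (simp add: free.scale_sum_right free.scale_right_diff_distrib sum_subtractf)
qed

section \<open>The bilinearity relations and the maps that respect them\<close>

locale tensor_pair = V1: kspace P1 + V2: kspace P2
  for P1 :: "('k::field, 'p) poisson" and P2 :: "('k, 'q) poisson"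
begin

abbreviation "FP \<equiv> free_product P1 P2"
abbreviation "TP \<equiv> tensor_product P1 P2"
abbreviation "Rel \<equiv> tensor_relations P1 P2"
abbreviation "pt \<equiv> pure_tensor P1 P2"

lemma free_product_simps [simp]:
  "carrier FP = {f. Poly_Mapping.keys f \<subseteq> carrier P1 \<times> carrier P2}"
  "add FP = (+)" "zero FP = 0" "smult FP = free_smult" "bracket FP = free_bracket P1 P2"
  by (simp_all add: free_product_def)

lemma keys_add_closed:
  "\<lbrakk>Poly_Mapping.keys f \<subseteq> X; Poly_Mapping.keys g \<subseteq> X\<rbrakk> \<Longrightarrow> Poly_Mapping.keys (f + g) \<subseteq> X"
  using keys_add[of f g] by blast

lemma keys_smult_closed: "Poly_Mapping.keys f \<subseteq> X \<Longrightarrow> Poly_Mapping.keys (free_smult c f) \<subseteq> X"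
  using keys_free_smult[of c f] by blast

lemma minus_eq_smult: "f - g = f + free_smult (-1) g" for f g :: "'i \<Rightarrow>\<^sub>0 'k"
  by (rule poly_mapping_eqI) (simp add: lookup_add lookup_minus)

lemma keys_diff_closed:
  "\<lbrakk>Poly_Mapping.keys f \<subseteq> X; Poly_Mapping.keys g \<subseteq> X\<rbrakk> \<Longrightarrow> Poly_Mapping.keys (f - g) \<subseteq> X"
  for f g :: "'i \<Rightarrow>\<^sub>0 'k"
  unfolding minus_eq_smult by (intro keys_add_closed keys_smult_closed)

lemma free_product_module: "Module.module class_ring FP"
proof (rule module_criteria)
  show "cring (class_ring :: 'k ring)" by (rule V1.R.cring_axioms)
  show "\<forall>v\<in>carrier FP. \<exists>neg_v\<in>carrier FP. v \<oplus>\<^bsub>FP\<^esub> neg_v = \<zero>\<^bsub>FP\<^esub>"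
  proof
    fix v assume v: "v \<in> carrier FP"
    show "\<exists>neg_v\<in>carrier FP. v \<oplus>\<^bsub>FP\<^esub> neg_v = \<zero>\<^bsub>FP\<^esub>"
      using v keys_smult_closed[of v _ "-1"] by (intro bexI[of _ "free_smult (-1) v"]) auto
  qed
qed (auto simp: free.scale_right_distrib free.scale_left_distrib ac_simps
    dest: subsetD[OF keys_add_closed] subsetD[OF keys_smult_closed])

lemma tensor_relators_closed: "tensor_relators P1 P2 \<subseteq> carrier FP"
proof
  fix r assume "r \<in> tensor_relators P1 P2"
  then show "r \<in> carrier FP"
    unfolding tensor_relators_def
    by (elim UnE CollectE exE conjE; simp only: free_product_simps mem_Collect_eq; intro keys_diff_closed; auto)
qed

lemma Rel_submodule: "submodule class_ring Rel FP"
  unfolding tensor_relations_def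
  by (rule module.span_is_submodule[OF free_product_module tensor_relators_closed])

lemma Rel_closed: "i \<in> Rel \<Longrightarrow> Poly_Mapping.keys i \<subseteq> carrier P1 \<times> carrier P2"
  using submodule.subset[OF Rel_submodule] by auto

lemma Rel_zero: "0 \<in> Rel"
  using submodule.zero_closed[OF Rel_submodule] by simp

lemma Rel_add: "i \<in> Rel \<Longrightarrow> j \<in> Rel \<Longrightarrow> i + j \<in> Rel"
  using submodule.m_closed[OF Rel_submodule] by simp

lemma Rel_smult: "i \<in> Rel \<Longrightarrow> free_smult c i \<in> Rel"
  using submodule.smult_closed[OF Rel_submodule] by simp

lemma Rel_diff: "i \<in> Rel \<Longrightarrow> j \<in> Rel \<Longrightarrow> i - j \<in> Rel"
  unfolding minus_eq_smult by (intro Rel_add Rel_smult)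

lemma Rel_sum: "(\<And>x. x \<in> A \<Longrightarrow> f x \<in> Rel) \<Longrightarrow> sum f A \<in> Rel"
  by (induction A rule: infinite_finite_induct) (auto simp: Rel_zero Rel_add)

lemma relator_in_Rel: "r \<in> tensor_relators P1 P2 \<Longrightarrow> r \<in> Rel"
  unfolding tensor_relations_def
  using module.in_own_span[OF free_product_module tensor_relators_closed] by blast

lemma Rel_add_left:
  "\<lbrakk>x \<in> carrier P1; y \<in> carrier P1; b \<in> carrier P2\<rbrakk> \<Longrightarrow>
    Poly_Mapping.single (x \<oplus>\<^bsub>P1\<^esub> y, b) 1 - Poly_Mapping.single (x, b) 1 - Poly_Mapping.single (y, b) 1 \<in> Rel"
  by (intro relator_in_Rel) (unfold tensor_relators_def, blast)

lemma Rel_add_right: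
  "\<lbrakk>a \<in> carrier P1; x \<in> carrier P2; y \<in> carrier P2\<rbrakk> \<Longrightarrow>
    Poly_Mapping.single (a, x \<oplus>\<^bsub>P2\<^esub> y) 1 - Poly_Mapping.single (a, x) 1 - Poly_Mapping.single (a, y) 1 \<in> Rel"
  by (intro relator_in_Rel) (unfold tensor_relators_def, blast)

lemma Rel_smult_left:
  "\<lbrakk>a \<in> carrier P1; b \<in> carrier P2\<rbrakk> \<Longrightarrow>
    Poly_Mapping.single (c \<odot>\<^bsub>P1\<^esub> a, b) 1 - Poly_Mapping.single (a, b) c \<in> Rel"
  by (intro relator_in_Rel) (unfold tensor_relators_def, blast)

lemma Rel_smult_right:
  "\<lbrakk>a \<in> carrier P1; b \<in> carrier P2\<rbrakk> \<Longrightarrow>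
    Poly_Mapping.single (a, c \<odot>\<^bsub>P2\<^esub> b) 1 - Poly_Mapping.single (a, b) c \<in> Rel"
  by (intro relator_in_Rel) (unfold tensor_relators_def, blast)

lemma Rel_induct [consumes 1, case_names add_left add_right smult_left smult_right zero add smult]:
  assumes "i \<in> Rel"
    and "\<And>x y b. \<lbrakk>x \<in> carrier P1; y \<in> carrier P1; b \<in> carrier P2\<rbrakk> \<Longrightarrow>
      Q (Poly_Mapping.single (x \<oplus>\<^bsub>P1\<^esub> y, b) 1 - Poly_Mapping.single (x, b) 1 - Poly_Mapping.single (y, b) 1)"
    and "\<And>a x y. \<lbrakk>a \<in> carrier P1; x \<in> carrier P2; y \<in> carrier P2\<rbrakk> \<Longrightarrow>
      Q (Poly_Mapping.single (a, x \<oplus>\<^bsub>P2\<^esub> y) 1 - Poly_Mapping.single (a, x) 1 - Poly_Mapping.single (a, y) 1)"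
    and "\<And>c a b. \<lbrakk>a \<in> carrier P1; b \<in> carrier P2\<rbrakk> \<Longrightarrow>
      Q (Poly_Mapping.single (c \<odot>\<^bsub>P1\<^esub> a, b) 1 - Poly_Mapping.single (a, b) c)"
    and "\<And>c a b. \<lbrakk>a \<in> carrier P1; b \<in> carrier P2\<rbrakk> \<Longrightarrow>
      Q (Poly_Mapping.single (a, c \<odot>\<^bsub>P2\<^esub> b) 1 - Poly_Mapping.single (a, b) c)"
    and "Q 0"
    and add: "\<And>f g. \<lbrakk>f \<in> carrier FP; g \<in> carrier FP; Q f; Q g\<rbrakk> \<Longrightarrow> Q (f + g)"
    and smult: "\<And>c f. \<lbrakk>f \<in> carrier FP; Q f\<rbrakk> \<Longrightarrow> Q (free_smult c f)"
  shows "Q i"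
  using assms(1)[unfolded tensor_relations_def] tensor_relators_closed
proof (rule module.span_induct[OF free_product_module])
  show "Q r" if "r \<in> tensor_relators P1 P2" for r
    using that unfolding tensor_relators_def by (elim UnE CollectE exE conjE; simp only: assms(2-5))
  show "Q \<zero>\<^bsub>FP\<^esub>" using assms(6) by simp
  show "Q (f \<oplus>\<^bsub>FP\<^esub> g)" if "f \<in> carrier FP" "g \<in> carrier FP" "Q f" "Q g" for f g
    using add[OF that] by simp
  show "Q (c \<odot>\<^bsub>FP\<^esub> f)" if "f \<in> carrier FP" "Q f" for c f
    using smult[OF that] by simp
qed

text \<open>A family indexed by the basis \<open>P\<^sub>1 \<times> P\<^sub>2\<close> is balanced if its linear extension descends to
  \<open>P\<^sub>1 \<otimes> P\<^sub>2\<close>.\<close>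

definition balanced :: "('p \<times> 'q \<Rightarrow> ('p \<times> 'q \<Rightarrow>\<^sub>0 'k)) \<Rightarrow> bool" where
  "balanced b \<longleftrightarrow>
     (\<forall>x\<in>carrier P1. \<forall>y\<in>carrier P1. \<forall>c\<in>carrier P2. b (x \<oplus>\<^bsub>P1\<^esub> y, c) - b (x, c) - b (y, c) \<in> Rel) \<and>
     (\<forall>a\<in>carrier P1. \<forall>x\<in>carrier P2. \<forall>y\<in>carrier P2. b (a, x \<oplus>\<^bsub>P2\<^esub> y) - b (a, x) - b (a, y) \<in> Rel) \<and>
     (\<forall>r. \<forall>a\<in>carrier P1. \<forall>c\<in>carrier P2. b (r \<odot>\<^bsub>P1\<^esub> a, c) - free_smult r (b (a, c)) \<in> Rel) \<and>
     (\<forall>r. \<forall>a\<in>carrier P1. \<forall>c\<in>carrier P2. b (a, r \<odot>\<^bsub>P2\<^esub> c) - free_smult r (b (a, c)) \<in> Rel)"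

text \<open>The four conditions in \<open>balanced\<close> say that \<open>free_ext b\<close> maps
  each kind of relator into \<open>Rel\<close>; linearity extends this to their span.\<close>

lemma balanced_free_ext:
  assumes b: "balanced b" and i: "i \<in> Rel"
  shows "free_ext b i \<in> Rel"
  using i
proof (induction rule: Rel_induct)
  case zero
  then show ?case by (simp add: Rel_zero)
next
  case (add f g)
  then show ?case by (simp add: free_ext_add Rel_add)
next
  case (smult c f)
  then show ?case by (simp add: free_ext_smult Rel_smult)
qed (use b in \<open>simp_all add: balanced_def free_ext_diff\<close>)

lemma balanced_plus: "\<lbrakk>balanced b; balanced b'\<rbrakk> \<Longrightarrow> balanced (\<lambda>p. b p + b' p)"
  unfolding balanced_def
proof (elim conjE, intro conjI ballI allI, goal_cases)
  case (1 x y c)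
  then have "(b (x \<oplus>\<^bsub>P1\<^esub> y, c) - b (x, c) - b (y, c)) + (b' (x \<oplus>\<^bsub>P1\<^esub> y, c) - b' (x, c) - b' (y, c)) \<in> Rel"
    by (intro Rel_add) auto
  then show ?case by (simp add: algebra_simps)
next
  case (2 a x y)
  then have "(b (a, x \<oplus>\<^bsub>P2\<^esub> y) - b (a, x) - b (a, y)) + (b' (a, x \<oplus>\<^bsub>P2\<^esub> y) - b' (a, x) - b' (a, y)) \<in> Rel"
    by (intro Rel_add) auto
  then show ?case by (simp add: algebra_simps)
next
  case (3 r a c)
  then have "(b (r \<odot>\<^bsub>P1\<^esub> a, c) - free_smult r (b (a, c))) + (b' (r \<odot>\<^bsub>P1\<^esub> a, c) - free_smult r (b' (a, c))) \<in> Rel"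
    by (intro Rel_add) auto
  then show ?case by (simp add: algebra_simps free.scale_right_distrib)
next
  case (4 r a c)
  then have "(b (a, r \<odot>\<^bsub>P2\<^esub> c) - free_smult r (b (a, c))) + (b' (a, r \<odot>\<^bsub>P2\<^esub> c) - free_smult r (b' (a, c))) \<in> Rel"
    by (intro Rel_add) auto
  then show ?case by (simp add: algebra_simps free.scale_right_distrib)
qed

lemma balanced_smult: "balanced b \<Longrightarrow> balanced (\<lambda>p. free_smult s (b p))"
  unfolding balanced_def
proof (elim conjE, intro conjI ballI allI, goal_cases)
  case (1 x y c)
  then have "free_smult s (b (x \<oplus>\<^bsub>P1\<^esub> y, c) - b (x, c) - b (y, c)) \<in> Rel"
    by (intro Rel_smult) auto
  then show ?case by (simp add: free.scale_right_diff_distrib)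
next
  case (2 a x y)
  then have "free_smult s (b (a, x \<oplus>\<^bsub>P2\<^esub> y) - b (a, x) - b (a, y)) \<in> Rel"
    by (intro Rel_smult) auto
  then show ?case by (simp add: free.scale_right_diff_distrib)
next
  case (3 r a c)
  then have "free_smult s (b (r \<odot>\<^bsub>P1\<^esub> a, c) - free_smult r (b (a, c))) \<in> Rel"
    by (intro Rel_smult) auto
  then show ?case by (simp add: free.scale_right_diff_distrib mult.commute)
next
  case (4 r a c)
  then have "free_smult s (b (a, r \<odot>\<^bsub>P2\<^esub> c) - free_smult r (b (a, c))) \<in> Rel"
    by (intro Rel_smult) auto
  then show ?case by (simp add: free.scale_right_diff_distrib mult.commute)
qed

lemma balanced_minus: "\<lbrakk>balanced b; balanced b'\<rbrakk> \<Longrightarrow> balanced (\<lambda>p. b p - b' p)"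
  unfolding minus_eq_smult by (intro balanced_plus balanced_smult)

text \<open>This family represents f \<otimes> g: applying linear maps to both factors turns
  relators into relators. The brackets are assembled from such families.\<close>

lemma balanced_single:
  assumes f: "f \<in> LinearCombinations.module_hom class_ring P1 P1"
    and g: "g \<in> LinearCombinations.module_hom class_ring P2 P2"
  shows "balanced (\<lambda>p. Poly_Mapping.single (f (fst p), g (snd p)) 1)"
proof -
  have "f x \<in> carrier P1" if "x \<in> carrier P1" for x
    using LinearCombinations.module_hom_closed[OF f] that by auto
  moreover have "g x \<in> carrier P2" if "x \<in> carrier P2" for x
    using LinearCombinations.module_hom_closed[OF g] that by auto
  ultimately show ?thesis
    unfolding balanced_def
    using LinearCombinations.module_hom_add[OF f] LinearCombinations.module_hom_add[OF g]
      LinearCombinations.module_hom_smult[OF f] LinearCombinations.module_hom_smult[OF g]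
    by (auto simp: Rel_add_left Rel_add_right Rel_smult_left Rel_smult_right)
qed

section \<open>Cosets of the relations\<close>

text \<open>Describing a coset as a congruence class reduces equality of cosets to membership of one
  difference in \<open>Rel\<close>.\<close>

definition cl :: "('p \<times> 'q \<Rightarrow>\<^sub>0 'k) \<Rightarrow> ('p \<times> 'q \<Rightarrow>\<^sub>0 'k) set" where
  "cl h = {f. f - h \<in> Rel}"

lemma coset_eq_cl: "Rel +>\<^bsub>FP\<^esub> h = cl h"
proof -
  have "f \<in> (\<lambda>i. i + h) ` Rel" if "f - h \<in> Rel" for f
    by (rule image_eqI[OF _ that]) simp
  then show ?thesis by (auto simp: cl_def a_r_coset_def')
qed

lemma cl_self: "h \<in> cl h"
  by (simp add: cl_def Rel_zero)

lemma cl_cong: "h - h' \<in> Rel \<Longrightarrow> cl h = cl h'"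
proof -
  assume a: "h - h' \<in> Rel"
  have "f - h \<in> Rel \<longleftrightarrow> f - h' \<in> Rel" for f
    using Rel_add[of "f - h" "h - h'"] Rel_diff[of "f - h'" "h - h'"] a by auto
  then show ?thesis by (simp add: cl_def)
qed

lemma tensor_carrier: "carrier TP = cl ` carrier FP"
  unfolding tensor_product_def Let_def FactRing_def
  by (auto simp: A_RCOSETS_def' coset_eq_cl simp del: free_product_simps)

lemma tensor_zero: "\<zero>\<^bsub>TP\<^esub> = cl 0"
  by (simp add: tensor_product_def Let_def FactRing_def cl_def)

lemma tensor_add: "cl f \<oplus>\<^bsub>TP\<^esub> cl g = cl (f + g)"
proof -
  have "h \<in> cl (f + g) \<longleftrightarrow> (\<exists>x\<in>cl f. \<exists>y\<in>cl g. h = x + y)" for h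
  proof
    assume "h \<in> cl (f + g)"
    then have "h - g \<in> cl f" by (simp add: cl_def algebra_simps)
    then show "\<exists>x\<in>cl f. \<exists>y\<in>cl g. h = x + y"
      using cl_self[of g] by (metis diff_add_cancel)
  next
    assume "\<exists>x\<in>cl f. \<exists>y\<in>cl g. h = x + y"
    then obtain x y where "x - f \<in> Rel" "y - g \<in> Rel" "h = x + y" by (auto simp: cl_def)
    then show "h \<in> cl (f + g)"
      using Rel_add[of "x - f" "y - g"] by (simp add: cl_def algebra_simps)
  qed
  then show ?thesis
    by (auto simp: tensor_product_def Let_def FactRing_def set_add_def')
qed

text \<open>The defining union over representatives collapses: each representative gives the same
  coset, and the index set contains \<open>h\<close>.\<close>

lemma tensor_smult: "c \<odot>\<^bsub>TP\<^esub> cl h = cl (free_smult c h)"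
proof -
  have "cl (free_smult c f) = cl (free_smult c h)" if "f \<in> cl h" for f
    using that Rel_smult[of "f - h" c] by (intro cl_cong) (simp add: cl_def free.scale_right_diff_distrib)
  then have "(\<Union>f\<in>cl h. cl (free_smult c f)) = (\<Union>f\<in>cl h. cl (free_smult c h))"
    by (intro SUP_cong refl)
  also have "\<dots> = cl (free_smult c h)" using cl_self[of h] by blast
  finally show ?thesis by (simp add: tensor_product_def Let_def coset_eq_cl)
qed

lemma pure_tensor_eq: "pt a b = cl (Poly_Mapping.single (a, b) 1)"
  by (simp add: pure_tensor_def coset_eq_cl)

lemma cl_closed: "Poly_Mapping.keys h \<subseteq> carrier P1 \<times> carrier P2 \<Longrightarrow> cl h \<in> carrier TP"
  by (auto simp: tensor_carrier)

lemma tensor_carrierE: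
  assumes "v \<in> carrier TP"
  obtains h where "v = cl h" "Poly_Mapping.keys h \<subseteq> carrier P1 \<times> carrier P2"
  using assms by (auto simp: tensor_carrier)

lemma tensor_kspace: "kspace TP"
proof (intro kspace.intro vs_criteria)
  show "field (class_ring :: 'k ring)" by (rule class_field)
  show "\<zero>\<^bsub>TP\<^esub> \<in> carrier TP" by (auto simp: tensor_zero intro: cl_closed)
  show "\<forall>v\<in>carrier TP. \<exists>neg_v\<in>carrier TP. v \<oplus>\<^bsub>TP\<^esub> neg_v = \<zero>\<^bsub>TP\<^esub>"
  proof
    fix v assume "v \<in> carrier TP"
    then obtain h where h: "v = cl h" "Poly_Mapping.keys h \<subseteq> carrier P1 \<times> carrier P2"
      by (auto simp: tensor_carrier)
    have "v \<oplus>\<^bsub>TP\<^esub> cl (free_smult (-1) h) = \<zero>\<^bsub>TP\<^esub>" by (simp add: h tensor_add tensor_zero)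
    then show "\<exists>neg_v\<in>carrier TP. v \<oplus>\<^bsub>TP\<^esub> neg_v = \<zero>\<^bsub>TP\<^esub>"
      using h keys_smult_closed by (intro bexI[of _ "cl (free_smult (-1) h)"] cl_closed) auto
  qed
  show "\<forall>v w. v \<in> carrier TP \<and> w \<in> carrier TP \<longrightarrow> v \<oplus>\<^bsub>TP\<^esub> w \<in> carrier TP"
    using tensor_add keys_add_closed by (metis cl_closed tensor_carrierE)
  show "\<forall>c v. c \<in> carrier class_ring \<and> v \<in> carrier TP \<longrightarrow> c \<odot>\<^bsub>TP\<^esub> v \<in> carrier TP"
    using tensor_smult keys_smult_closed by (metis cl_closed tensor_carrierE)
qed (auto simp: tensor_carrier tensor_add tensor_smult tensor_zero ac_simps
    free.scale_right_distrib free.scale_left_distrib)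

lemma pt_closed: "\<lbrakk>a \<in> carrier P1; b \<in> carrier P2\<rbrakk> \<Longrightarrow> pt a b \<in> carrier TP"
  unfolding pure_tensor_eq by (rule cl_closed) auto

lemma pt_add_left:
  "\<lbrakk>x \<in> carrier P1; y \<in> carrier P1; b \<in> carrier P2\<rbrakk> \<Longrightarrow> pt (x \<oplus>\<^bsub>P1\<^esub> y) b = pt x b \<oplus>\<^bsub>TP\<^esub> pt y b"
  unfolding pure_tensor_eq tensor_add
  by (rule cl_cong) (use Rel_add_left[of x y b] in \<open>simp add: algebra_simps\<close>)

lemma pt_add_right:
  "\<lbrakk>a \<in> carrier P1; x \<in> carrier P2; y \<in> carrier P2\<rbrakk> \<Longrightarrow> pt a (x \<oplus>\<^bsub>P2\<^esub> y) = pt a x \<oplus>\<^bsub>TP\<^esub> pt a y"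
  unfolding pure_tensor_eq tensor_add
  by (rule cl_cong) (use Rel_add_right[of a x y] in \<open>simp add: algebra_simps\<close>)

lemma pt_smult_left:
  "\<lbrakk>a \<in> carrier P1; b \<in> carrier P2\<rbrakk> \<Longrightarrow> pt (c \<odot>\<^bsub>P1\<^esub> a) b = c \<odot>\<^bsub>TP\<^esub> pt a b"
  unfolding pure_tensor_eq tensor_smult
  by (rule cl_cong) (simp add: Rel_smult_left)

lemma pt_smult_right:
  "\<lbrakk>a \<in> carrier P1; b \<in> carrier P2\<rbrakk> \<Longrightarrow> pt a (c \<odot>\<^bsub>P2\<^esub> b) = c \<odot>\<^bsub>TP\<^esub> pt a b"
  unfolding pure_tensor_eq tensor_smult
  by (rule cl_cong) (simp add: Rel_smult_right)

lemma tensor_spanned: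
  "carrier TP \<subseteq> span_of TP {pt a b |a b. a \<in> carrier P1 \<and> b \<in> carrier P2}"
proof
  interpret TP: kspace TP by (rule tensor_kspace)
  let ?G = "{pt a b |a b. a \<in> carrier P1 \<and> b \<in> carrier P2}"
  have G: "?G \<subseteq> carrier TP" using pt_closed by blast
  note sub = TP.span_is_submodule[OF G]
  fix v assume "v \<in> carrier TP"
  then obtain h where v: "v = cl h" and "Poly_Mapping.keys h \<subseteq> carrier P1 \<times> carrier P2"
    by (rule tensor_carrierE)
  from this(2) have "cl h \<in> TP.span ?G"
  proof (induction h rule: poly_mapping_keys_induct)
    case zero
    then show ?case using submodule.zero_closed[OF sub] by (simp add: tensor_zero)
  next
    case (single p c)
    then obtain a b where p: "p = (a, b)" "a \<in> carrier P1" "b \<in> carrier P2" by blast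
    have "cl (Poly_Mapping.single p c) = c \<odot>\<^bsub>TP\<^esub> pt a b"
      by (simp add: p pure_tensor_eq tensor_smult)
    moreover have "pt a b \<in> TP.span ?G" using TP.in_own_span[OF G] p by blast
    ultimately show ?case using submodule.smult_closed[OF sub] by simp
  next
    case (add f g)
    then show ?case using submodule.m_closed[OF sub] by (simp add: tensor_add[symmetric])
  qed
  then show "v \<in> TP.span ?G" by (simp add: v)
qed

text \<open>Extend \<beta> linearly to the free space; bilinearity makes the extension vanish on the
  relators, so it factors through the cosets.\<close>

lemma tensor_universal:
  fixes V :: "('k, 'v, 'm) module_scheme"
  assumes "Module.module class_ring V"
    and closed: "\<And>a b. \<lbrakk>a \<in> carrier P1; b \<in> carrier P2\<rbrakk> \<Longrightarrow> \<beta> a b \<in> carrier V"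
    and add_left: "\<And>x y b. \<lbrakk>x \<in> carrier P1; y \<in> carrier P1; b \<in> carrier P2\<rbrakk> \<Longrightarrow>
      \<beta> (x \<oplus>\<^bsub>P1\<^esub> y) b = \<beta> x b \<oplus>\<^bsub>V\<^esub> \<beta> y b"
    and add_right: "\<And>a x y. \<lbrakk>a \<in> carrier P1; x \<in> carrier P2; y \<in> carrier P2\<rbrakk> \<Longrightarrow>
      \<beta> a (x \<oplus>\<^bsub>P2\<^esub> y) = \<beta> a x \<oplus>\<^bsub>V\<^esub> \<beta> a y"
    and smult_left: "\<And>c a b. \<lbrakk>a \<in> carrier P1; b \<in> carrier P2\<rbrakk> \<Longrightarrow> \<beta> (c \<odot>\<^bsub>P1\<^esub> a) b = c \<odot>\<^bsub>V\<^esub> \<beta> a b"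
    and smult_right: "\<And>c a b. \<lbrakk>a \<in> carrier P1; b \<in> carrier P2\<rbrakk> \<Longrightarrow> \<beta> a (c \<odot>\<^bsub>P2\<^esub> b) = c \<odot>\<^bsub>V\<^esub> \<beta> a b"
  obtains L where "L \<in> LinearCombinations.module_hom class_ring TP V"
    "\<And>a b. \<lbrakk>a \<in> carrier P1; b \<in> carrier P2\<rbrakk> \<Longrightarrow> L (pt a b) = \<beta> a b"
proof -
  interpret V: Module.module class_ring V by fact
  let ?X = "carrier P1 \<times> carrier P2"
  obtain M where M_closed: "\<And>h. Poly_Mapping.keys h \<subseteq> ?X \<Longrightarrow> M h \<in> carrier V"
    and M_add: "\<And>h h'. Poly_Mapping.keys h \<subseteq> ?X \<Longrightarrow> Poly_Mapping.keys h' \<subseteq> ?X \<Longrightarrow> M (h + h') = M h \<oplus>\<^bsub>V\<^esub> M h'"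
    and M_smult: "\<And>c h. Poly_Mapping.keys h \<subseteq> ?X \<Longrightarrow> M (free_smult c h) = c \<odot>\<^bsub>V\<^esub> M h"
    and M_single: "\<And>p c. p \<in> ?X \<Longrightarrow> M (Poly_Mapping.single p c) = c \<odot>\<^bsub>V\<^esub> \<beta> (fst p) (snd p)"
    using linear_extension_from_free[OF assms(1), of ?X "\<lambda>p. \<beta> (fst p) (snd p)"] closed by (auto simp: mem_Times_iff)
  have one: "1 \<odot>\<^bsub>V\<^esub> v = v" if "v \<in> carrier V" for v
    using V.smult_one[OF that] by simp
  have smult_closed: "c \<odot>\<^bsub>V\<^esub> v \<in> carrier V" if "v \<in> carrier V" for c v
    using V.smult_closed[of c v] that by simp
  \<comment> \<open>Subtraction is reached through additivity: cancel \<open>M g\<close> in M f = M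
    (f - g) + M g.\<close>
  have M_diff: "M (f - g) = \<zero>\<^bsub>V\<^esub>" if "Poly_Mapping.keys f \<subseteq> ?X" "Poly_Mapping.keys g \<subseteq> ?X" "M f = M g" for f g
  proof -
    have d: "Poly_Mapping.keys (f - g) \<subseteq> ?X" using that by (intro keys_diff_closed)
    have "M f = M (f - g) \<oplus>\<^bsub>V\<^esub> M g" using M_add[OF d that(2)] by simp
    then show ?thesis using that M_closed d by (metis V.M.add.r_cancel_one')
  qed
  have M_Rel: "M i = \<zero>\<^bsub>V\<^esub>" if "i \<in> Rel" for i
    using that
  proof (induction rule: Rel_induct)
    case (add_left x y b)
    then show ?case
      \<comment> \<open>Regroups the relator as one difference f - (g + h), the shape that
        \<open>M_diff\<close> expects.\<close>
      unfolding diff_diff_eq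
      by (intro M_diff keys_add_closed) (auto simp: M_add M_single one closed assms(3))
  next
    case (add_right a x y)
    then show ?case
      unfolding diff_diff_eq
      by (intro M_diff keys_add_closed) (auto simp: M_add M_single one closed assms(4))
  next
    case (smult_left c a b)
    then show ?case
      by (intro M_diff) (auto simp: M_single one closed smult_closed assms(5))
  next
    case (smult_right c a b)
    then show ?case
      by (intro M_diff) (auto simp: M_single one closed smult_closed assms(6))
  next
    case zero
    show ?case using M_diff[of 0 0] by simp
  next
    case (add f g)
    then show ?case by (simp add: M_add)
  next
    case (smult c f)
    then show ?case using V.smult_r_null[of c] by (simp add: M_smult)
  qed
  \<comment> \<open>An arbitrary representative may be used, since two of them differ by an element
    of \<open>Rel\<close>, where \<open>M\<close> vanishes.\<close>
  define L where "L v = M (SOME h. h \<in> v)" for v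
  have L_cl: "L (cl h) = M h" if h: "Poly_Mapping.keys h \<subseteq> ?X" for h
  proof -
    have "(SOME f. f \<in> cl h) \<in> cl h" using cl_self by (rule someI)
    then have r: "(SOME f. f \<in> cl h) - h \<in> Rel" by (simp add: cl_def)
    have "M ((SOME f. f \<in> cl h) - h + h) = M ((SOME f. f \<in> cl h) - h) \<oplus>\<^bsub>V\<^esub> M h"
      using Rel_closed[OF r] h by (rule M_add)
    then show ?thesis using M_Rel[OF r] M_closed[OF h] by (simp add: L_def)
  qed
  show thesis
  proof
    show "L (pt a b) = \<beta> a b" if "a \<in> carrier P1" "b \<in> carrier P2" for a b
      using that by (simp add: pure_tensor_eq L_cl M_single one closed)
    show "L \<in> LinearCombinations.module_hom class_ring TP V"
      unfolding LinearCombinations.module_hom_def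
    proof (intro CollectI conjI allI impI Pi_I)
      fix v assume "v \<in> carrier TP"
      then show "L v \<in> carrier V" by (elim tensor_carrierE) (simp add: L_cl M_closed)
    next
      fix v w assume "v \<in> carrier TP \<and> w \<in> carrier TP"
      then show "L (v \<oplus>\<^bsub>TP\<^esub> w) = L v \<oplus>\<^bsub>V\<^esub> L w"
        by (elim conjE tensor_carrierE) (simp add: L_cl M_add tensor_add keys_add_closed)
    next
      fix c :: 'k and v assume "c \<in> carrier class_ring \<and> v \<in> carrier TP"
      then show "L (c \<odot>\<^bsub>TP\<^esub> v) = c \<odot>\<^bsub>V\<^esub> L v"
        by (elim conjE tensor_carrierE) (simp add: L_cl M_smult tensor_smult keys_smult_closed)
    qed
  qed
qed

text \<open>The contractions are induced by the bilinear maps sending (a, b) to g(a) b and to f(b)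
  a.\<close>

lemma tensor_product_tensor_space: "tensor_space P1 P2 TP pt"
proof (intro tensor_space.intro tensor_space_axioms.intro tensor_kspace V1.kspace_axioms V2.kspace_axioms
    pt_closed pt_add_left pt_add_right pt_smult_left pt_smult_right tensor_spanned)
  fix g assume g: "linear_form P1 g"
  obtain L where "L \<in> LinearCombinations.module_hom class_ring TP P2"
    "\<And>a b. \<lbrakk>a \<in> carrier P1; b \<in> carrier P2\<rbrakk> \<Longrightarrow> L (pt a b) = g a \<odot>\<^bsub>P2\<^esub> b"
    by (rule tensor_universal[OF V2.module_axioms, of "\<lambda>a b. g a \<odot>\<^bsub>P2\<^esub> b"])
      (use g V2.smult_l_distr V2.smult_r_distr in \<open>auto simp: linear_form_def V2.smult_smult mult.commute\<close>)
  then show "\<exists>L. contraction P1 P2 TP pt g L" by (auto simp: contraction_def)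
next
  fix f assume f: "linear_form P2 f"
  obtain L where "L \<in> LinearCombinations.module_hom class_ring TP P1"
    "\<And>a b. \<lbrakk>a \<in> carrier P1; b \<in> carrier P2\<rbrakk> \<Longrightarrow> L (pt a b) = f b \<odot>\<^bsub>P1\<^esub> a"
    by (rule tensor_universal[OF V1.module_axioms, of "\<lambda>a b. f b \<odot>\<^bsub>P1\<^esub> a"])
      (use f V1.smult_l_distr V1.smult_r_distr in \<open>auto simp: linear_form_def V1.smult_smult mult.commute\<close>)
  then show "\<exists>L. contraction P2 P1 TP (\<lambda>b a. pt a b) f L" by (auto simp: contraction_def)
qed

end

section \<open>The bracket of the tensor product\<close>

context nc_poisson_algebra
begin

lemma kspace: "kspace P"
  by (intro kspace.intro vectorspace_axioms)

lemma bracket_left_hom: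
  "x \<in> carrier P \<Longrightarrow> (\<lambda>y. bracket P y x) \<in> LinearCombinations.module_hom class_ring P P"
  by (auto simp: LinearCombinations.module_hom_def bracket_closed bracket_add_left bracket_smult_left)

lemma bracket_right_hom:
  "x \<in> carrier P \<Longrightarrow> bracket P x \<in> LinearCombinations.module_hom class_ring P P"
  by (auto simp: LinearCombinations.module_hom_def bracket_closed bracket_add_right bracket_smult_right)

lemma mult_left_hom:
  "x \<in> carrier P \<Longrightarrow> (\<lambda>y. y \<otimes> x) \<in> LinearCombinations.module_hom class_ring P P"
  by (auto simp: LinearCombinations.module_hom_def A.l_distr smult_mult_left)

lemma mult_right_hom:
  "x \<in> carrier P \<Longrightarrow> (\<lambda>y. x \<otimes> y) \<in> LinearCombinations.module_hom class_ring P P"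
  by (auto simp: LinearCombinations.module_hom_def A.r_distr smult_mult_right)

lemma ad_linear: "z \<in> carrier P \<Longrightarrow> ad_linear P z"
  using bracket_right_hom[of z]
  by (intro ad_linear.intro ad_linear_axioms.intro kspace) (simp add: ad_def[abs_def])

text \<open>Leibniz on 1 = 1 1 gives {x, 1} = {x, 1} + {x, 1}.\<close>

lemma bracket_one_right: "x \<in> carrier P \<Longrightarrow> bracket P x \<one> = \<zero>"
  using leibniz[of x \<one> \<one>] bracket_closed[of x \<one>] by simp

text \<open>Polarisation: expand {1 + x, 1 + x} = 0 and use that {x, 1} vanishes.\<close>

lemma bracket_one_left: "x \<in> carrier P \<Longrightarrow> bracket P \<one> x = \<zero>"
  using bracket_self[of "\<one> \<oplus> x"] bracket_self[of x] bracket_one_right[of x] bracket_one_right[of \<one>]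
  by (simp add: bracket_add_left bracket_add_right bracket_closed)

end

locale poisson_pair = A1: nc_poisson_algebra P1 + A2: nc_poisson_algebra P2
  for P1 :: "('k::field, 'p) poisson" and P2 :: "('k, 'q) poisson" +
  assumes same_class: "(class1 P1 \<and> class1 P2) \<or> (class2 P1 \<and> class2 P2)"

sublocale poisson_pair \<subseteq> tensor_pair P1 P2
  by (intro tensor_pair.intro A1.kspace A2.kspace)

context poisson_pair
begin

text \<open>In both classes the bracket is the bilinear extension of its values on the basis.\<close>

definition basis_bracket :: "'p \<times> 'q \<Rightarrow> 'p \<times> 'q \<Rightarrow> ('p \<times> 'q \<Rightarrow>\<^sub>0 'k)" where
  "basis_bracket p q =
     (if class1 P1 \<and> class1 P2
      then Poly_Mapping.single (bracket P1 (fst p) (fst q), snd p \<otimes>\<^bsub>P2\<^esub> snd q) 1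
         + Poly_Mapping.single (fst q \<otimes>\<^bsub>P1\<^esub> fst p, bracket P2 (snd p) (snd q)) 1
      else Poly_Mapping.single (fst p \<otimes>\<^bsub>P1\<^esub> fst q, snd p \<otimes>\<^bsub>P2\<^esub> snd q) 1
         - Poly_Mapping.single (fst q \<otimes>\<^bsub>P1\<^esub> fst p, snd q \<otimes>\<^bsub>P2\<^esub> snd p) 1)"

lemma free_bracket_eq: "free_bracket P1 P2 f g = bilinear_ext basis_bracket f g"
proof (cases "class1 P1 \<and> class1 P2")
  case True
  then show ?thesis
    by (simp add: free_bracket_def basis_bracket_def[abs_def] case_prod_beta')
next
  case False
  then show ?thesis
    by (simp add: free_bracket_def basis_bracket_def[abs_def] free_mult_def bilinear_ext_diff case_prod_beta'
        del: de_Morgan_conj)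
qed

text \<open>With \<open>q\<close> fixed, each summand of either formula applies a one-sided product
  or bracket, a linear map, to each component of \<open>p\<close>; so \<open>balanced_single\<close>
  covers all of them.\<close>

lemma balanced_basis_bracket_left:
  assumes "q \<in> carrier P1 \<times> carrier P2"
  shows "balanced (\<lambda>p. basis_bracket p q)"
proof -
  have q: "fst q \<in> carrier P1" "snd q \<in> carrier P2" using assms by auto
  show ?thesis
    using balanced_plus[OF balanced_single[OF A1.bracket_left_hom[OF q(1)] A2.mult_left_hom[OF q(2)]]
        balanced_single[OF A1.mult_right_hom[OF q(1)] A2.bracket_left_hom[OF q(2)]]]
      balanced_minus[OF balanced_single[OF A1.mult_left_hom[OF q(1)] A2.mult_left_hom[OF q(2)]]
        balanced_single[OF A1.mult_right_hom[OF q(1)] A2.mult_right_hom[OF q(2)]]]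
    by (cases "class1 P1 \<and> class1 P2") (simp_all add: basis_bracket_def del: de_Morgan_conj)
qed

lemma balanced_basis_bracket_right:
  assumes "p \<in> carrier P1 \<times> carrier P2"
  shows "balanced (basis_bracket p)"
proof -
  have p: "fst p \<in> carrier P1" "snd p \<in> carrier P2" using assms by auto
  show ?thesis
    using balanced_plus[OF balanced_single[OF A1.bracket_right_hom[OF p(1)] A2.mult_right_hom[OF p(2)]]
        balanced_single[OF A1.mult_left_hom[OF p(1)] A2.bracket_right_hom[OF p(2)]]]
      balanced_minus[OF balanced_single[OF A1.mult_right_hom[OF p(1)] A2.mult_right_hom[OF p(2)]]
        balanced_single[OF A1.mult_left_hom[OF p(1)] A2.mult_left_hom[OF p(2)]]]
    by (cases "class1 P1 \<and> class1 P2") (simp_all add: basis_bracket_def[abs_def] del: de_Morgan_conj)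
qed

lemma basis_bracket_closed:
  assumes "p \<in> carrier P1 \<times> carrier P2" "q \<in> carrier P1 \<times> carrier P2"
  shows "Poly_Mapping.keys (basis_bracket p q) \<subseteq> carrier P1 \<times> carrier P2"
proof -
  have "fst p \<in> carrier P1" "snd p \<in> carrier P2" "fst q \<in> carrier P1" "snd q \<in> carrier P2"
    using assms by auto
  then show ?thesis
    unfolding basis_bracket_def
    by (simp only: split: if_split)
      (intro conjI impI keys_add_closed keys_diff_closed; simp add: A1.bracket_closed A2.bracket_closed)
qed

lemma free_bracket_add_left: "free_bracket P1 P2 (f + f') g = free_bracket P1 P2 f g + free_bracket P1 P2 f' g"
  by (simp add: free_bracket_eq bilinear_ext_eq free_ext_add)

lemma free_bracket_diff_left: "free_bracket P1 P2 (f - f') g = free_bracket P1 P2 f g - free_bracket P1 P2 f' g"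
  by (simp add: free_bracket_eq bilinear_ext_eq free_ext_diff)

lemma free_bracket_add_right: "free_bracket P1 P2 f (g + g') = free_bracket P1 P2 f g + free_bracket P1 P2 f g'"
  by (simp add: free_bracket_eq bilinear_ext_eq_swap free_ext_add)

lemma free_bracket_diff_right: "free_bracket P1 P2 f (g - g') = free_bracket P1 P2 f g - free_bracket P1 P2 f g'"
  by (simp add: free_bracket_eq bilinear_ext_eq_swap free_ext_diff)

lemma free_bracket_smult_right: "free_bracket P1 P2 f (free_smult c g) = free_smult c (free_bracket P1 P2 f g)"
  by (simp add: free_bracket_eq bilinear_ext_eq_swap free_ext_smult)

lemma free_bracket_single:
  "free_bracket P1 P2 (Poly_Mapping.single p 1) (Poly_Mapping.single q 1) = basis_bracket p q"
  by (simp add: free_bracket_eq bilinear_ext_eq)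

text \<open>With the sum over the keys of \<open>g\<close> outermost, each term is a multiple of a
  balanced extension evaluated at \<open>i\<close>. Together with the mirror statement,
  \<open>Rel\<close> is an ideal for the bracket.\<close>

lemma free_bracket_Rel_left:
  assumes "i \<in> Rel" "Poly_Mapping.keys g \<subseteq> carrier P1 \<times> carrier P2"
  shows "free_bracket P1 P2 i g \<in> Rel"
  unfolding free_bracket_eq bilinear_ext_eq_swap free_ext_def[of _ g]
  using assms by (intro Rel_sum Rel_smult balanced_free_ext balanced_basis_bracket_left) auto

lemma free_bracket_Rel_right:
  assumes "i \<in> Rel" "Poly_Mapping.keys f \<subseteq> carrier P1 \<times> carrier P2"
  shows "free_bracket P1 P2 f i \<in> Rel"
  unfolding free_bracket_eq bilinear_ext_eq free_ext_def[of _ f]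
  using assms by (intro Rel_sum Rel_smult balanced_free_ext balanced_basis_bracket_right) auto

lemma free_bracket_closed:
  assumes "Poly_Mapping.keys f \<subseteq> carrier P1 \<times> carrier P2" "Poly_Mapping.keys g \<subseteq> carrier P1 \<times> carrier P2"
  shows "Poly_Mapping.keys (free_bracket P1 P2 f g) \<subseteq> carrier P1 \<times> carrier P2"
proof -
  have sum_closed: "Poly_Mapping.keys (sum h A) \<subseteq> X" if "\<And>x. x \<in> A \<Longrightarrow> Poly_Mapping.keys (h x) \<subseteq> X"
    for A :: "('p \<times> 'q) set" and h :: "'p \<times> 'q \<Rightarrow> ('p \<times> 'q \<Rightarrow>\<^sub>0 'k)" and X
    using that
  proof (induction A rule: infinite_finite_induct)
    case (insert x A)
    then have "Poly_Mapping.keys (h x + sum h A) \<subseteq> X" by (intro keys_add_closed) auto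
    then show ?case using insert.hyps by simp
  qed auto
  show ?thesis
    unfolding free_bracket_eq bilinear_ext_def
    by (intro sum_closed keys_smult_closed basis_bracket_closed subsetD[OF assms(1)] subsetD[OF assms(2)])
qed

lemma tensor_bracket:
  assumes h: "Poly_Mapping.keys h \<subseteq> carrier P1 \<times> carrier P2" and k: "Poly_Mapping.keys k \<subseteq> carrier P1 \<times> carrier P2"
  shows "bracket TP (cl h) (cl k) = cl (free_bracket P1 P2 h k)"
proof -
  have "cl (free_bracket P1 P2 f g) = cl (free_bracket P1 P2 h k)" if "f \<in> cl h" "g \<in> cl k" for f g
  proof (rule cl_cong)
    have r: "f - h \<in> Rel" "g - k \<in> Rel" using that by (auto simp: cl_def)
    \<comment> \<open>The representative \<open>g\<close> is known only through its coset; its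
      support is controlled by writing it as \<open>(g - k) + k\<close>.\<close>
    have "Poly_Mapping.keys ((g - k) + k) \<subseteq> carrier P1 \<times> carrier P2"
      by (intro keys_add_closed Rel_closed r k)
    \<comment> \<open>The telescoping identity {f, g} - {h, k} = {f - h, g} + {h, g - k} changes one
      argument at a time.\<close>
    then have "free_bracket P1 P2 (f - h) g + free_bracket P1 P2 h (g - k) \<in> Rel"
      using r h by (intro Rel_add free_bracket_Rel_left free_bracket_Rel_right) auto
    then show "free_bracket P1 P2 f g - free_bracket P1 P2 h k \<in> Rel"
      by (simp add: free_bracket_diff_left free_bracket_diff_right)
  qed
  then have "(\<Union>f\<in>cl h. \<Union>g\<in>cl k. cl (free_bracket P1 P2 f g)) = (\<Union>f\<in>cl h. \<Union>g\<in>cl k. cl (free_bracket P1 P2 h k))"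
    by (intro SUP_cong refl)
  also have "\<dots> = cl (free_bracket P1 P2 h k)" using cl_self[of h] cl_self[of k] by blast
  finally show ?thesis by (simp add: tensor_product_def Let_def coset_eq_cl)
qed

text \<open>Needed for Class 2, where the commutator of z \<otimes> 1 and a \<otimes> b is a
  difference of two pure tensors with the same right factor.\<close>

lemma cl_diff_pure:
  assumes "a \<in> carrier P1" "a' \<in> carrier P1" "b \<in> carrier P2"
  shows "cl (Poly_Mapping.single (a, b) 1 - Poly_Mapping.single (a', b) 1) = pt (a \<ominus>\<^bsub>P1\<^esub> a') b"
proof -
  have "a \<ominus>\<^bsub>P1\<^esub> a' = a \<oplus>\<^bsub>P1\<^esub> (-1) \<odot>\<^bsub>P1\<^esub> a'"
    using V1.smult_minus_one[OF assms(2)] by (simp add: a_minus_def)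
  then have "pt (a \<ominus>\<^bsub>P1\<^esub> a') b = pt a b \<oplus>\<^bsub>TP\<^esub> (-1) \<odot>\<^bsub>TP\<^esub> pt a' b"
    using assms by (simp add: pt_add_left pt_smult_left)
  also have "\<dots> = cl (Poly_Mapping.single (a, b) 1 - Poly_Mapping.single (a', b) 1)"
    unfolding pure_tensor_eq tensor_smult tensor_add minus_eq_smult ..
  finally show ?thesis ..
qed

lemma cl_diff_pure_right:
  assumes "a \<in> carrier P1" "b \<in> carrier P2" "b' \<in> carrier P2"
  shows "cl (Poly_Mapping.single (a, b) 1 - Poly_Mapping.single (a, b') 1) = pt a (b \<ominus>\<^bsub>P2\<^esub> b')"
proof -
  have "b \<ominus>\<^bsub>P2\<^esub> b' = b \<oplus>\<^bsub>P2\<^esub> (-1) \<odot>\<^bsub>P2\<^esub> b'"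
    using V2.smult_minus_one[OF assms(3)] by (simp add: a_minus_def)
  then have "pt a (b \<ominus>\<^bsub>P2\<^esub> b') = pt a b \<oplus>\<^bsub>TP\<^esub> (-1) \<odot>\<^bsub>TP\<^esub> pt a b'"
    using assms by (simp add: pt_add_right pt_smult_right)
  also have "\<dots> = cl (Poly_Mapping.single (a, b) 1 - Poly_Mapping.single (a, b') 1)"
    unfolding pure_tensor_eq tensor_smult tensor_add minus_eq_smult ..
  finally show ?thesis ..
qed

interpretation TS: tensor_space P1 P2 TP pt
  by (rule tensor_product_tensor_space)

text \<open>Both classes give the same value: in Class 1 the second summand contains {1, b} = 0, and
  in Class 2 the unit commutes with b, leaving the commutator of z and a.\<close>

lemma cl_basis_bracket_left:
  assumes z: "z \<in> carrier P1" and a: "a \<in> carrier P1" and b: "b \<in> carrier P2"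
  shows "cl (basis_bracket (z, \<one>\<^bsub>P2\<^esub>) (a, b)) = pt (bracket P1 z a) b"
proof (cases "class1 P1 \<and> class1 P2")
  case True
  have "cl (basis_bracket (z, \<one>\<^bsub>P2\<^esub>) (a, b)) = pt (bracket P1 z a) b \<oplus>\<^bsub>TP\<^esub> pt (a \<otimes>\<^bsub>P1\<^esub> z) \<zero>\<^bsub>P2\<^esub>"
    using True b by (simp add: basis_bracket_def pure_tensor_eq tensor_add A2.bracket_one_left)
  also have "\<dots> = pt (bracket P1 z a) b"
    using assms by (simp add: A1.bracket_closed)
  finally show ?thesis .
next
  case False
  then have "bracket P1 z a = z \<otimes>\<^bsub>P1\<^esub> a \<ominus>\<^bsub>P1\<^esub> a \<otimes>\<^bsub>P1\<^esub> z"
    using same_class z a by (auto simp: class2_def)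
  then show ?thesis
    using False assms cl_diff_pure[of "z \<otimes>\<^bsub>P1\<^esub> a" "a \<otimes>\<^bsub>P1\<^esub> z" b] by (simp add: basis_bracket_def del: de_Morgan_conj)
qed

lemma cl_basis_bracket_right:
  assumes z: "z \<in> carrier P2" and a: "a \<in> carrier P1" and b: "b \<in> carrier P2"
  shows "cl (basis_bracket (\<one>\<^bsub>P1\<^esub>, z) (a, b)) = pt a (bracket P2 z b)"
proof (cases "class1 P1 \<and> class1 P2")
  case True
  have "cl (basis_bracket (\<one>\<^bsub>P1\<^esub>, z) (a, b)) = pt \<zero>\<^bsub>P1\<^esub> (z \<otimes>\<^bsub>P2\<^esub> b) \<oplus>\<^bsub>TP\<^esub> pt a (bracket P2 z b)"
    using True a by (simp add: basis_bracket_def pure_tensor_eq tensor_add A1.bracket_one_left)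
  also have "\<dots> = pt a (bracket P2 z b)"
    using assms by (simp add: A2.bracket_closed)
  finally show ?thesis .
next
  case False
  then have "bracket P2 z b = z \<otimes>\<^bsub>P2\<^esub> b \<ominus>\<^bsub>P2\<^esub> b \<otimes>\<^bsub>P2\<^esub> z"
    using same_class z b by (auto simp: class2_def)
  then show ?thesis
    using False assms cl_diff_pure_right[of a "z \<otimes>\<^bsub>P2\<^esub> b" "b \<otimes>\<^bsub>P2\<^esub> z"] by (simp add: basis_bracket_def del: de_Morgan_conj)
qed

lemma tensor_product_tensor_ad:
  assumes z: "z1 \<in> carrier P1" "z2 \<in> carrier P2"
  shows "tensor_ad P1 P2 TP pt z1 z2 (pt z1 \<one>\<^bsub>P2\<^esub> \<oplus>\<^bsub>TP\<^esub> pt \<one>\<^bsub>P1\<^esub> z2)"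
proof -
  \<comment> \<open>A representative of \<Gamma> in the free space, on which \<open>ad\<close> can
    be computed by \<open>tensor_bracket\<close>.\<close>
  define \<gamma> where "\<gamma> = Poly_Mapping.single (z1, \<one>\<^bsub>P2\<^esub>) (1::'k) + Poly_Mapping.single (\<one>\<^bsub>P1\<^esub>, z2) 1"
  have \<gamma>: "pt z1 \<one>\<^bsub>P2\<^esub> \<oplus>\<^bsub>TP\<^esub> pt \<one>\<^bsub>P1\<^esub> z2 = cl \<gamma>"
    by (simp add: pure_tensor_eq tensor_add \<gamma>_def)
  have \<gamma>_closed: "Poly_Mapping.keys \<gamma> \<subseteq> carrier P1 \<times> carrier P2"
    unfolding \<gamma>_def using z by (intro keys_add_closed) auto
  have ad_cl: "ad TP (cl \<gamma>) (cl h) = cl (free_bracket P1 P2 \<gamma> h)"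
    if "Poly_Mapping.keys h \<subseteq> carrier P1 \<times> carrier P2" for h
    unfolding ad_def using \<gamma>_closed that by (rule tensor_bracket)
  have "ad TP (cl \<gamma>) \<in> LinearCombinations.module_hom class_ring TP TP"
    unfolding LinearCombinations.module_hom_def
  proof (intro CollectI conjI allI impI Pi_I)
    fix v assume "v \<in> carrier TP"
    then show "ad TP (cl \<gamma>) v \<in> carrier TP"
      by (elim tensor_carrierE) (simp add: ad_cl cl_closed free_bracket_closed \<gamma>_closed)
  next
    fix v w assume "v \<in> carrier TP \<and> w \<in> carrier TP"
    then show "ad TP (cl \<gamma>) (v \<oplus>\<^bsub>TP\<^esub> w) = ad TP (cl \<gamma>) v \<oplus>\<^bsub>TP\<^esub> ad TP (cl \<gamma>) w"
      by (elim conjE tensor_carrierE) (simp add: ad_cl tensor_add keys_add_closed free_bracket_add_right)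
  next
    fix c :: 'k and v assume "c \<in> carrier class_ring \<and> v \<in> carrier TP"
    then show "ad TP (cl \<gamma>) (c \<odot>\<^bsub>TP\<^esub> v) = c \<odot>\<^bsub>TP\<^esub> ad TP (cl \<gamma>) v"
      by (elim conjE tensor_carrierE) (simp add: ad_cl tensor_smult keys_smult_closed free_bracket_smult_right)
  qed
  then have G: "ad_linear TP (cl \<gamma>)"
    by (intro ad_linear.intro ad_linear_axioms.intro tensor_kspace)
  have "ad TP (cl \<gamma>) (pt a b) = pt (ad P1 z1 a) b \<oplus>\<^bsub>TP\<^esub> pt a (ad P2 z2 b)"
    if "a \<in> carrier P1" "b \<in> carrier P2" for a b
  proof -
    have "ad TP (cl \<gamma>) (pt a b) = cl (free_bracket P1 P2 \<gamma> (Poly_Mapping.single (a, b) 1))"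
      unfolding pure_tensor_eq using that by (intro ad_cl) simp
    also have "\<dots> = cl (basis_bracket (z1, \<one>\<^bsub>P2\<^esub>) (a, b)) \<oplus>\<^bsub>TP\<^esub> cl (basis_bracket (\<one>\<^bsub>P1\<^esub>, z2) (a, b))"
      by (simp add: \<gamma>_def free_bracket_add_left free_bracket_single tensor_add)
    finally show ?thesis
      using that z by (simp add: cl_basis_bracket_left cl_basis_bracket_right ad_def)
  qed
  then show ?thesis
    unfolding \<gamma> using z
    by (intro tensor_ad.intro tensor_ad_axioms.intro tensor_product_tensor_space A1.ad_linear A2.ad_linear G)
qed

end

theorem corollary6p9:
  fixes P1 :: "('k::{alg_closed_field, field_char_0}, 'p) poisson"
    and P2 :: "('k, 'q) poisson"
    and u1 :: "'p \<Rightarrow> int extended" and u2 :: "'q \<Rightarrow> int extended"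
    and z1 :: 'p and z2 :: 'q
  assumes "nc_poisson_algebra P1" and "nc_poisson_algebra P2"
    and "(class1 P1 \<and> class1 P2) \<or> (class2 P1 \<and> class2 P2)"
    and "degree_map P1 u1" and "nonneg_valued P1 u1"
    and "finite_filtration P1 u1" and "discrete_filtration P1 u1"
    and "degree_map P2 u2" and "nonneg_valued P2 u2"
    and "finite_filtration P2 u2" and "discrete_filtration P2 u2"
    and "z1 \<in> carrier P1" and "z2 \<in> carrier P2"
    and "F_ad P1 z1 = C_ad P1 z1" and "C_ad P1 z1 \<subset> carrier P1"
  shows "let T = tensor_product P1 P2;
             \<Gamma> = pure_tensor P1 P2 z1 \<one>\<^bsub>P2\<^esub> \<oplus>\<^bsub>T\<^esub> pure_tensor P1 P2 \<one>\<^bsub>P1\<^esub> z2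
         in F_ad T \<Gamma> = tensor_subspace P1 P2 (C_ad P1 z1) (F_ad P2 z2)
          \<and> N_ad T \<Gamma> = tensor_subspace P1 P2 (C_ad P1 z1) (N_ad P2 z2)
          \<and> D_ad T \<Gamma> = tensor_subspace P1 P2 (C_ad P1 z1) (D_ad P2 z2)
          \<and> C_ad T \<Gamma> = tensor_subspace P1 P2 (C_ad P1 z1) (C_ad P2 z2)
          \<and> (z2 \<in> Omega0 P2 \<union> Omega0' P2 \<longrightarrow> \<Gamma> \<in> Omega0' T)
          \<and> (z2 \<in> Omega1 P2 \<union> Omega1' P2 \<longrightarrow> \<Gamma> \<in> Omega1' T)
          \<and> (z2 \<in> Omega2 P2 \<union> Omega2' P2 \<longrightarrow> \<Gamma> \<in> Omega2' T)
          \<and> (z2 \<in> Omega3 P2 \<union> Omega3' P2 \<longrightarrow> \<Gamma> \<in> Omega3' T)"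
proof -
  interpret poisson_pair P1 P2
    using assms(1-3) by (intro poisson_pair.intro poisson_pair_axioms.intro)
  define \<Gamma> where "\<Gamma> = pt z1 \<one>\<^bsub>P2\<^esub> \<oplus>\<^bsub>TP\<^esub> pt \<one>\<^bsub>P1\<^esub> z2"
  interpret TA: tensor_ad P1 P2 TP pt z1 z2 \<Gamma>
    unfolding \<Gamma>_def by (rule tensor_product_tensor_ad[OF assms(12,13)])
  have \<Gamma>_closed: "\<Gamma> \<in> carrier TP"
    unfolding \<Gamma>_def using assms(12,13) by simp
  have tens: "tensor_subspace P1 P2 A B = TA.tens A B" for A B
    by (simp add: tensor_subspace_def TA.tens_def)
  \<comment> \<open>The unit witnesses that C(z1) is nonzero: 1 = 0 would force P1 = 0, leaving no
    room for a proper subspace.\<close>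
  have "\<one>\<^bsub>P1\<^esub> \<in> C_ad P1 z1"
    using assms(12) by (simp add: C_ad_def ad_def A1.bracket_one_right)
  moreover have "\<one>\<^bsub>P1\<^esub> \<noteq> \<zero>\<^bsub>P1\<^esub>"
  proof
    assume "\<one>\<^bsub>P1\<^esub> = \<zero>\<^bsub>P1\<^esub>"
    then have "carrier P1 = {\<zero>\<^bsub>P1\<^esub>}" by (rule A1.A.one_zeroD)
    then show False
      using assms(15) submodule.zero_closed[OF TA.A1.C_ad_submodule] by auto
  qed
  ultimately have nonzero: "C_ad P1 z1 \<noteq> {\<zero>\<^bsub>P1\<^esub>}" by auto
  note types = assms(14) assms(15) nonzero \<Gamma>_closed
  show ?thesis
    unfolding Let_def \<Gamma>_def[symmetric] tens
    using TA.F_ad_eq_tens[OF assms(14)] TA.N_ad_eq_tens[OF assms(14)] TA.D_ad_eq_tens[OF assms(14)]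
      TA.C_ad_eq_tens[OF assms(14)]
      TA.Omega0'_if[OF types] TA.Omega1'_if[OF types] TA.Omega2'_if[OF types] TA.Omega3'_if[OF types]
    by blast
qed

end
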